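(* Let $\mathfrak{K_V}=(A,B(x),\mathbb X(x);\sigma_1,\sigma_2,\gamma,\gamma_*(x);\mathcal H,\mathbb C^2;\mathrm I)$ be a Sturm-Liouville vessel with potential $q(x)=2\beta'(x)$ and tau function $\tau(x)=\det(\mathbb X^{-1}(x_0)\mathbb X(x))$, $x_0\in\mathrm I$. Then $$q(x)=-2\frac{d^2}{dx^2}\ln\tau(x).$$
   Context: Sturm-Liouville (SL) vessel parameters on $\mathcal E=\mathbb C^2$: $$\sigma_1=\begin{bmatrix}0&1\\1&0\end{bmatrix},\ \sigma_2=\begin{bmatrix}1&0\\0&0\end{bmatrix},\ \gamma=\begin{bmatrix}0&0\\0&i\end{bmatrix},\ \gamma_*(x)=\begin{bmatrix}-i(\beta'(x)-\beta^2(x))&-\beta(x)\\ \beta(x)&i\end{bmatrix},$$ where $\beta$ is a real valued differentiable function on an interval $\mathrm I$. An SL vessel on $\mathrm I$ is a collection $(A,B(x),\mathbb X(x);\sigma_1,\sigma_2,\gamma,\gamma_*(x);\mathcal H,\mathbb C^2;\mathrm I)$ with these parameters, where $\mathcal H$ is a Hilbert space, $A,\mathbb X(x):\mathcal H\to\mathcal H$ ($A$ possibly unbounded with domain $D(A)$) and $B(x):\mathbb C^2\to\mathcal H$ satisfy the regularity assumptions: there is a point $x_1\in\mathrm I$ with $B(x_1)\mathbb C^2\subseteq D(A^n)$ and $\|A^nB(x_1)\|\le(C\sqrt n)^n$ for all $n\ge1$ and some $C>0$; $\mathbb X(x)$ is self-adjoint and invertible for all $x\in\mathrm I$; and the vessel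 conditions $$0=\tfrac{d}{dx}(B(x)\sigma_1)+AB(x)\sigma_2+B(x)\gamma,\quad A\mathbb X(x)+\mathbb X(x)A^*+B(x)\sigma_1B^*(x)=0,\quad \tfrac{d}{dx}\mathbb X(x)=B(x)\sigma_2B^*(x),$$ $$\gamma_*(x)=\gamma+\sigma_2B^*(x)\mathbb X^{-1}(x)B(x)\sigma_1-\sigma_1B^*(x)\mathbb X^{-1}(x)B(x)\sigma_2.$$ The determinant in $\tau$ is the Fredholm determinant ($\mathbb X^{-1}(x_0)\mathbb X(x)$ is of the form identity plus trace class). *)

theory Defs
  imports "HOL-Complex_Analysis.Complex_Analysis" "HOL-Combinatorics.Permutations"
begin

text \<open>The inner product is conjugate-linear in the first argument. Positivity of
  \<open>cinner x x\<close> follows from \<open>norm_eq_sqrt_cinner\<close>, since norms are nonnegative and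
  \<open>sqrt\<close> is negative on negative reals.\<close>

class complex_hilbert_space = banach +
  fixes scaleC :: "complex \<Rightarrow> 'a \<Rightarrow> 'a" (infixr "*\<^sub>C" 75)
    and cinner :: "'a \<Rightarrow> 'a \<Rightarrow> complex"
  assumes scaleC_add_right: "c *\<^sub>C (x + y) = c *\<^sub>C x + c *\<^sub>C y"
    and scaleC_add_left: "(c + d) *\<^sub>C x = c *\<^sub>C x + d *\<^sub>C x"
    and scaleC_scaleC: "c *\<^sub>C d *\<^sub>C x = (c * d) *\<^sub>C x"
    and scaleC_of_real: "complex_of_real r *\<^sub>C x = r *\<^sub>R x"
    and cinner_commute: "cinner x y = cnj (cinner y x)"
    and cinner_add_right: "cinner x (y + z) = cinner x y + cinner x z"
    and cinner_scaleC_right: "cinner x (c *\<^sub>C y) = c * cinner x y"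
    and norm_eq_sqrt_cinner: "norm x = sqrt (Re (cinner x x))"

instantiation complex :: complex_hilbert_space
begin
definition scaleC_complex :: "complex \<Rightarrow> complex \<Rightarrow> complex"
  where "scaleC_complex c x = c * x"
definition cinner_complex :: "complex \<Rightarrow> complex \<Rightarrow> complex"
  where "cinner_complex x y = cnj x * y"
instance
  by standard
    (simp_all add: scaleC_complex_def cinner_complex_def algebra_simps scaleR_conv_of_real
      cmod_def power2_eq_square)
end

instantiation vec :: (complex_hilbert_space, finite) complex_hilbert_space
begin
definition scaleC_vec :: "complex \<Rightarrow> 'a ^ 'b \<Rightarrow> 'a ^ 'b"
  where "scaleC_vec c x = (\<chi> i. c *\<^sub>C (x $ i))"
definition cinner_vec :: "'a ^ 'b \<Rightarrow> 'a ^ 'b \<Rightarrow> complex"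
  where "cinner_vec x y = (\<Sum>i\<in>UNIV. cinner (x $ i) (y $ i))"
instance
proof
  fix x y z :: "'a ^ 'b" and c d :: complex and r :: real
  show "c *\<^sub>C (x + y) = c *\<^sub>C x + c *\<^sub>C y"
    by (simp add: scaleC_vec_def vec_eq_iff scaleC_add_right)
  show "(c + d) *\<^sub>C x = c *\<^sub>C x + d *\<^sub>C x"
    by (simp add: scaleC_vec_def vec_eq_iff scaleC_add_left)
  show "c *\<^sub>C d *\<^sub>C x = (c * d) *\<^sub>C x"
    by (simp add: scaleC_vec_def vec_eq_iff scaleC_scaleC)
  show "complex_of_real r *\<^sub>C x = r *\<^sub>R x"
    by (simp add: scaleC_vec_def vec_eq_iff scaleC_of_real)
  show "cinner x y = cnj (cinner y x)"
    unfolding cinner_vec_def cnj_sum by (intro sum.cong refl cinner_commute)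
  show "cinner x (y + z) = cinner x y + cinner x z"
    by (simp add: cinner_vec_def cinner_add_right sum.distrib)
  show "cinner x (c *\<^sub>C y) = c * cinner x y"
    by (simp add: cinner_vec_def scaleC_vec_def cinner_scaleC_right sum_distrib_left)
  have "(norm (x $ i))\<^sup>2 = Re (cinner (x $ i) (x $ i))" for i
    by (metis norm_eq_sqrt_cinner norm_ge_zero real_sqrt_ge_0_iff real_sqrt_pow2)
  then show "norm x = sqrt (Re (cinner x x))"
    by (simp add: norm_vec_def L2_set_def cinner_vec_def)
qed
end

definition bounded_clinear :: "('a::complex_hilbert_space \<Rightarrow> 'b::complex_hilbert_space) \<Rightarrow> bool"
  where "bounded_clinear T \<longleftrightarrow> bounded_linear T \<and> (\<forall>c x. T (c *\<^sub>C x) = c *\<^sub>C T x)"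

text \<open>A possibly unbounded operator is a pair of a domain and a total function, of which only the
  values on the domain matter.\<close>

definition clinear_on :: "'a::complex_hilbert_space set \<Rightarrow> ('a \<Rightarrow> 'b::complex_hilbert_space) \<Rightarrow> bool"
  where "clinear_on D T \<longleftrightarrow>
    0 \<in> D \<and> (\<forall>x\<in>D. \<forall>y\<in>D. x + y \<in> D \<and> T (x + y) = T x + T y)
    \<and> (\<forall>c. \<forall>x\<in>D. c *\<^sub>C x \<in> D \<and> T (c *\<^sub>C x) = c *\<^sub>C T x)"

definition power_domain :: "'a set \<Rightarrow> ('a \<Rightarrow> 'a) \<Rightarrow> nat \<Rightarrow> 'a set"
  where "power_domain D T n = {x. \<forall>k<n. (T ^^ k) x \<in> D}"

definition adj_domain :: "'a::complex_hilbert_space set \<Rightarrow> ('a \<Rightarrow> 'b::complex_hilbert_space) \<Rightarrow> 'b set"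
  where "adj_domain D T = {h. \<exists>g. \<forall>f\<in>D. cinner (T f) h = cinner f g}"

text \<open>Uniquely determined on \<open>adj_domain D T\<close> when \<open>D\<close> is dense.\<close>

definition adj_on :: "'a::complex_hilbert_space set \<Rightarrow> ('a \<Rightarrow> 'b::complex_hilbert_space) \<Rightarrow> 'b \<Rightarrow> 'a"
  where "adj_on D T h = (THE g. \<forall>f\<in>D. cinner (T f) h = cinner f g)"

abbreviation adj :: "('a::complex_hilbert_space \<Rightarrow> 'b::complex_hilbert_space) \<Rightarrow> 'b \<Rightarrow> 'a"
  where "adj \<equiv> adj_on UNIV"

definition orthonormal_basis :: "'a::complex_hilbert_space set \<Rightarrow> bool"
  where "orthonormal_basis E \<longleftrightarrow>
    (\<forall>e\<in>E. \<forall>f\<in>E. cinner e f = (if e = f then 1 else 0))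
    \<and> (\<forall>h. (\<forall>e\<in>E. cinner e h = 0) \<longrightarrow> h = 0)"

text \<open>For a finite orthonormal set \<open>F = {e\<^sub>1, \<dots>, e\<^sub>k}\<close>, the determinant of the matrix
  \<open>(\<langle>e\<^sub>a, T e\<^sub>b\<rangle>)\<close>; it is the diagonal matrix entry of the \<open>k\<close>-th exterior power of
  \<open>T\<close> at \<open>e\<^sub>1 \<and> \<dots> \<and> e\<^sub>k\<close>.\<close>

definition principal_minor :: "('a::complex_hilbert_space \<Rightarrow> 'a) \<Rightarrow> 'a set \<Rightarrow> complex"
  where "principal_minor T F =
    (\<Sum>p | p permutes F. of_int (sign p) * (\<Prod>e\<in>F. cinner e (T (p e))))"

definition trace_ext_power :: "nat \<Rightarrow> ('a::complex_hilbert_space \<Rightarrow> 'a) \<Rightarrow> complex"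
  where "trace_ext_power k T =
    (let E = (SOME E. orthonormal_basis E)
     in \<Sum>\<^sub>\<infinity>F\<in>{F. F \<subseteq> E \<and> finite F \<and> card F = k}. principal_minor T F)"

text \<open>\<open>det (1 + T) = \<Sum>\<^sub>k tr (\<Lambda>\<^sup>k T)\<close>. For trace class \<open>T\<close> all the sums converge
  absolutely and do not depend on the basis; other arguments are not meaningful.\<close>

definition fredholm_det :: "('a::complex_hilbert_space \<Rightarrow> 'a) \<Rightarrow> complex"
  where "fredholm_det S = (\<Sum>k. trace_ext_power k (\<lambda>h. S h - h))"

definition sigma1 :: "complex ^ 2 ^ 2"
  where "sigma1 = vector [vector [0, 1], vector [1, 0]]"

definition sigma2 :: "complex ^ 2 ^ 2"
  where "sigma2 = vector [vector [1, 0], vector [0, 0]]"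

definition gamma :: "complex ^ 2 ^ 2"
  where "gamma = vector [vector [0, 0], vector [0, \<i>]]"

text \<open>Derivatives on the interval \<open>I\<close> are taken within \<open>I\<close>, hence one-sided at endpoints
  belonging to \<open>I\<close>.\<close>

definition gamma_star :: "real set \<Rightarrow> (real \<Rightarrow> real) \<Rightarrow> real \<Rightarrow> complex ^ 2 ^ 2"
  where "gamma_star I \<beta> x =
    vector [vector [- \<i> * of_real (vector_derivative \<beta> (at x within I) - (\<beta> x)\<^sup>2), - of_real (\<beta> x)],
            vector [of_real (\<beta> x), \<i>]]"

definition sl_potential :: "real set \<Rightarrow> (real \<Rightarrow> real) \<Rightarrow> real \<Rightarrow> real"
  where "sl_potential I \<beta> x = 2 * vector_derivative \<beta> (at x within I)"

text \<open>The operator equations are stated on vectors. The Lyapunov equation is an identity on the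
  domain of the adjoint of \<open>A\<close>, which includes that \<open>X x\<close> maps this domain into the domain of
  \<open>A\<close>. The derivative of \<open>X\<close> is required in the strong operator topology only; as
  \<open>B\<close> is norm continuous, it is then also a derivative in operator norm.\<close>

locale sl_vessel =
  fixes DA :: "'h::complex_hilbert_space set"
    and A :: "'h \<Rightarrow> 'h"
    and B :: "real \<Rightarrow> complex ^ 2 \<Rightarrow> 'h"
    and X :: "real \<Rightarrow> 'h \<Rightarrow> 'h"
    and \<beta> :: "real \<Rightarrow> real"
    and I :: "real set"
  assumes interval: "is_interval I" "\<exists>a\<in>I. \<exists>b\<in>I. a < b"
    and beta_differentiable: "\<beta> differentiable_on I"
    and A_linear: "clinear_on DA A"
    and A_dense: "closure DA = UNIV"
    and B_bounded: "x \<in> I \<Longrightarrow> bounded_clinear (B x)"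
    and X_bounded: "x \<in> I \<Longrightarrow> bounded_clinear (X x)"
    and regular: "\<exists>x1\<in>I. \<exists>C>0. \<forall>n\<ge>1.
      (\<forall>v. B x1 v \<in> power_domain DA A n)
      \<and> onorm (\<lambda>v. (A ^^ n) (B x1 v)) \<le> (C * sqrt (real n)) ^ n"
    and X_selfadjoint: "x \<in> I \<Longrightarrow> cinner (X x u) v = cinner u (X x v)"
    and X_invertible: "x \<in> I \<Longrightarrow> bij (X x) \<and> bounded_clinear (inv (X x))"
    and B_sigma2_domain: "x \<in> I \<Longrightarrow> B x (sigma2 *v w) \<in> DA"
    and B_deriv: "x \<in> I \<Longrightarrow> ((\<lambda>y. B y (sigma1 *v w)) has_vector_derivative
      - (A (B x (sigma2 *v w)) + B x (gamma *v w))) (at x within I)"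
    and lyapunov: "x \<in> I \<Longrightarrow> h \<in> adj_domain DA A \<Longrightarrow> X x h \<in> DA \<and>
      A (X x h) + X x (adj_on DA A h) + B x (sigma1 *v adj (B x) h) = 0"
    and X_deriv: "x \<in> I \<Longrightarrow> ((\<lambda>y. X y h) has_vector_derivative
      B x (sigma2 *v adj (B x) h)) (at x within I)"
    and linkage: "x \<in> I \<Longrightarrow> gamma_star I \<beta> x *v w = gamma *v w
      + sigma2 *v adj (B x) (inv (X x) (B x (sigma1 *v w)))
      - sigma1 *v adj (B x) (inv (X x) (B x (sigma2 *v w)))"

text \<open>Integrating \<open>X_deriv\<close>, the operator below is the identity plus the trace class operator
  \<open>inv (X x0) (\<integral> b\<^sub>1 b\<^sub>1\<^sup>* )\<close> with \<open>b\<^sub>1 y = B y (axis 1 1)\<close>. Self-adjointness and invertibility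
  of \<open>X\<close> make the determinant real and nonzero, and it is 1 at \<open>x0\<close>; so it is positive on the
  interval, and its complex logarithm is the real one.\<close>

definition vessel_tau :: "(real \<Rightarrow> 'h \<Rightarrow> 'h::complex_hilbert_space) \<Rightarrow> real \<Rightarrow> real \<Rightarrow> complex"
  where "vessel_tau X x0 x = fredholm_det (inv (X x0) \<circ> X x)"

end

theory Submission
  imports Defs
begin

text \<open>Write \<open>b = B(axis 1 1)\<close> for the first column of \<open>B\<close>. The condition on the derivative of \<open>X\<close>
  says that \<open>X' = b b\<^sup>*\<close> has rank one, and an off-diagonal entry of the linkage condition
  says \<open>\<beta> = -\<langle>b, X\<^sup>-\<^sup>1 b\<rangle>\<close> (\<open>beta_eq\<close>). Formally,
  \<open>(ln \<tau>)' = tr (X\<^sup>-\<^sup>1 X') = \<langle>b, X\<^sup>-\<^sup>1 b\<rangle> = -\<beta>\<close>, and one more derivative gives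
  \<open>-2 (ln \<tau>)'' = 2 \<beta>'\<close>. The work lies in Jacobi's formula for the Fredholm determinant.

  It is obtained from finite determinants. Put \<open>N(y) = X(x\<^sub>0)\<^sup>-\<^sup>1 X(y)\<close>, let \<open>E\<close> be an orthonormal
  basis, and for finite \<open>S \<subseteq> E\<close> let \<open>D\<^sub>S\<close> be the determinant of the compression of \<open>N\<close> to
  the span of \<open>S\<close>. The limit of \<open>D\<^sub>S\<close> as \<open>S\<close> exhausts \<open>E\<close> is computed in two ways.

  First, \<open>D\<^sub>S\<close> is the sum of the principal minors of \<open>N - 1\<close> over all \<open>F \<subseteq> S\<close>
  (\<open>gdet_identity_plus\<close>). These minors are absolutely summable over all finite \<open>F \<subseteq> E\<close>
  (\<open>minors_summable\<close>), so \<open>D\<^sub>S \<rightarrow> \<tau>\<close> (\<open>fredholm_det_limit\<close>). For the summability,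
  the differences of \<open>X\<close> are semidefinite, and Cauchy--Schwarz bounds the entries of \<open>N - 1\<close> by
  \<open>\<alpha>\<^sub>e \<gamma>\<^sub>f\<close> with \<open>s\<^sub>e = \<alpha>\<^sub>e \<gamma>\<^sub>e\<close> summable. The Leibniz formula then bounds the minor of \<open>F\<close> by
  \<open>(card F)! \<Prod> s\<^sub>e\<close>, and the factorial is harmless once finitely many indices are split off, because
  the products over \<open>k\<close>-element sets add up to at most \<open>(\<Sum> s\<^sub>e)\<^sup>k / k!\<close>
  (\<open>fact_weight_bounded\<close>).

  Secondly, by Jacobi's formula and Cramer's rule, \<open>D\<^sub>S' = \<langle>b, z\<rangle>\<close> with \<open>z\<close> in the span of \<open>S\<close>
  solving \<open>P N z = D\<^sub>S P c\<close>, where \<open>c = X(x\<^sub>0)\<^sup>-\<^sup>1 b\<close> and \<open>P\<close> projects onto this span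
  (\<open>finite_det_derivative\<close>). On a compact segment \<open>P c\<close> approximates \<open>c\<close> uniformly and \<open>N\<close> is
  uniformly bounded below, so \<open>D\<^sub>S' = (-\<beta> + o(1)) D\<^sub>S\<close> uniformly
  (\<open>finite_det_log_derivative\<close>). As \<open>D\<^sub>S(x\<^sub>0) = 1\<close>, this gives \<open>D\<^sub>S \<rightarrow> exp G\<close> with
  \<open>G' = -\<beta>\<close> and \<open>G(x\<^sub>0) = 0\<close> (\<open>finite_det_limit\<close>).

  Hence \<open>\<tau> = exp G\<close>, which is positive, so that the principal logarithm of \<open>\<tau>\<close> is \<open>G\<close>.\<close>

section \<open>Geometry of the Hilbert space\<close>

lemma cinner_add_left: "cinner (x + y) z = cinner x z + cinner y z"
  by (metis cinner_add_right cinner_commute complex_cnj_add)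

lemma cinner_scaleC_left: "cinner (c *\<^sub>C x) y = cnj c * cinner x y"
  by (metis cinner_commute cinner_scaleC_right complex_cnj_mult)

lemma cinner_zero_right [simp]: "cinner x 0 = 0"
  using cinner_add_right[of x 0 0] by simp

lemma cinner_zero_left [simp]: "cinner 0 x = 0"
  using cinner_add_left[of 0 0 x] by simp

lemma scaleC_one [simp]: "1 *\<^sub>C x = x"
  using scaleC_of_real[of 1 x] by simp

lemma scaleC_minus1: "(- 1) *\<^sub>C x = - x"
  using scaleC_of_real[of "-1" x] by simp

lemma cinner_minus_right [simp]: "cinner x (- y) = - cinner x y"
  using cinner_scaleC_right[of x "-1" y] by (simp add: scaleC_minus1)

lemma cinner_minus_left [simp]: "cinner (- x) y = - cinner x y"
  using cinner_scaleC_left[of "-1" x y] by (simp add: scaleC_minus1)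

lemma cinner_diff_right: "cinner x (y - z) = cinner x y - cinner x z"
  using cinner_add_right[of x y "- z"] by simp

lemma cinner_diff_left: "cinner (x - y) z = cinner x z - cinner y z"
  using cinner_add_left[of x "- y" z] by simp

lemma cinner_sum_right: "cinner x (\<Sum>i\<in>A. f i) = (\<Sum>i\<in>A. cinner x (f i))"
  by (induction A rule: infinite_finite_induct) (simp_all add: cinner_add_right)

lemma cinner_sum_left: "cinner (\<Sum>i\<in>A. f i) x = (\<Sum>i\<in>A. cinner (f i) x)"
  by (induction A rule: infinite_finite_induct) (simp_all add: cinner_add_left)

lemma cinner_scaleR_right: "cinner x (r *\<^sub>R y) = r *\<^sub>R cinner x y"
  by (metis cinner_scaleC_right scaleC_of_real scaleR_conv_of_real)

lemma cinner_scaleR_left: "cinner (r *\<^sub>R x) y = r *\<^sub>R cinner x y"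
  by (metis cinner_scaleC_left complex_cnj_complex_of_real scaleC_of_real scaleR_conv_of_real)

lemma Im_cinner_self [simp]: "Im (cinner x x) = 0"
  using arg_cong[OF cinner_commute[of x x], of Im] by simp

lemma cinner_self: "cinner x x = of_real ((norm x)\<^sup>2)"
proof -
  have "0 \<le> Re (cinner x x)"
    using norm_ge_zero[of x] unfolding norm_eq_sqrt_cinner by (rule iffD1[OF real_sqrt_ge_0_iff])
  then show ?thesis
    by (simp add: complex_eq_iff norm_eq_sqrt_cinner)
qed

text \<open>The discriminant argument for \<open>[u,v] = \<langle>u,Tv\<rangle>\<close>: the form is nonnegative on \<open>u - t[v,u]v\<close> for every real
  \<open>t\<close>, and a degenerate \<open>v\<close> is handled by letting \<open>t\<close> be large.\<close>

lemma psd_Cauchy_Schwarz: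
  fixes T :: "'h::complex_hilbert_space \<Rightarrow> 'h"
  assumes T: "bounded_clinear T"
    and herm: "\<And>u v. cinner (T u) v = cinner u (T v)"
    and psd: "\<And>u. 0 \<le> Re (cinner u (T u))"
  shows "(norm (cinner u (T v)))\<^sup>2 \<le> Re (cinner u (T u)) * Re (cinner v (T v))"
proof -
  define a b z where "a = Re (cinner u (T u))" and "b = Re (cinner v (T v))" and "z = cinner v (T u)"
  interpret T: bounded_linear T using T by (simp add: bounded_clinear_def)
  have Tc: "T (c *\<^sub>C x) = c *\<^sub>C T x" for c x using T by (simp add: bounded_clinear_def)
  have uv: "cinner u (T v) = cnj z"
    unfolding z_def by (metis cinner_commute herm)
  have real: "cinner x (T x) = of_real (Re (cinner x (T x)))" for x
  proof -
    have "cinner x (T x) = cnj (cinner x (T x))" by (metis cinner_commute herm)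
    then show ?thesis by (metis Reals_cnj_iff of_real_Re)
  qed
  have quad: "0 \<le> a - 2 * t * (norm z)\<^sup>2 + t\<^sup>2 * (norm z)\<^sup>2 * b" for t :: real
  proof -
    define c where "c = of_real t * z"
    have "cinner (u - c *\<^sub>C v) (T (u - c *\<^sub>C v))
        = cinner u (T u) - c * cinner u (T v) - cnj c * z + cnj c * c * cinner v (T v)"
      by (simp add: T.diff Tc cinner_diff_left cinner_diff_right cinner_scaleC_left
          cinner_scaleC_right algebra_simps z_def)
    also have "\<dots> = of_real (a - 2 * t * (norm z)\<^sup>2 + t\<^sup>2 * (norm z)\<^sup>2 * b)"
    proof -
      have "z * cnj z = of_real ((norm z)\<^sup>2)" by (simp only: complex_norm_square)
      moreover have "cinner u (T u) = of_real a" "cinner v (T v) = of_real b"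
        unfolding a_def b_def by (fact real)+
      ultimately show ?thesis
        unfolding c_def uv complex_cnj_mult complex_cnj_complex_of_real of_real_diff of_real_add
          of_real_mult of_real_power of_real_numeral by algebra
    qed
    finally show ?thesis using psd[of "u - c *\<^sub>C v"] by (metis Re_complex_of_real)
  qed
  have b0: "0 \<le> b" unfolding b_def by (rule psd)
  have "(norm z)\<^sup>2 \<le> a * b"
  proof (cases "b = 0")
    case True
    have "norm z = 0"
    proof (rule ccontr)
      assume "norm z \<noteq> 0"
      then have "2 * ((a + 1) / (2 * (norm z)\<^sup>2)) * (norm z)\<^sup>2 = a + 1" by simp
      then show False using quad[of "(a + 1) / (2 * (norm z)\<^sup>2)"] True by simp
    qed
    then show ?thesis using True by simp
  next
    case False
    then have "0 < b" using b0 by simp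
    then show ?thesis using quad[of "1 / b"]
      by (simp add: field_simps power2_eq_square)
  qed
  then show ?thesis by (simp add: uv a_def b_def)
qed

lemma norm_cinner_le: "norm (cinner x y) \<le> norm x * norm y"
proof -
  have "(norm (cinner x y))\<^sup>2 \<le> (norm x * norm y)\<^sup>2"
    using psd_Cauchy_Schwarz[of "\<lambda>x. x" x y]
    by (simp add: bounded_clinear_def bounded_linear_ident cinner_self power_mult_distrib)
  then show ?thesis by (simp add: power2_le_iff_abs_le)
qed

lemma bounded_bilinear_cinner: "bounded_bilinear cinner"
  by standard
    (auto simp: cinner_add_left cinner_add_right cinner_scaleR_left cinner_scaleR_right
      intro!: exI[of _ 1] norm_cinner_le)

lemma norm_scaleC: "norm (c *\<^sub>C x) = norm c * norm x"
proof -
  have "complex_of_real ((norm (c *\<^sub>C x))\<^sup>2) = (c * cnj c) * of_real ((norm x)\<^sup>2)"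
    unfolding cinner_self[symmetric] cinner_scaleC_left cinner_scaleC_right by simp
  also have "\<dots> = of_real ((norm c * norm x)\<^sup>2)"
    unfolding complex_norm_square[symmetric] by (simp add: power_mult_distrib)
  finally have "complex_of_real ((norm (c *\<^sub>C x))\<^sup>2) = of_real ((norm c * norm x)\<^sup>2)" .
  then have "(norm (c *\<^sub>C x))\<^sup>2 = (norm c * norm x)\<^sup>2" by (simp only: of_real_eq_iff)
  then show ?thesis by (simp add: power2_eq_iff_nonneg)
qed

lemma bounded_bilinear_scaleC: "bounded_bilinear (\<lambda>c (x :: 'h::complex_hilbert_space). c *\<^sub>C x)"
proof
  fix a a' :: complex and b b' :: 'h and r :: real
  show "(a + a') *\<^sub>C b = a *\<^sub>C b + a' *\<^sub>C b" by (rule scaleC_add_left)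
  show "a *\<^sub>C (b + b') = a *\<^sub>C b + a *\<^sub>C b'" by (rule scaleC_add_right)
  show "(r *\<^sub>R a) *\<^sub>C b = r *\<^sub>R (a *\<^sub>C b)"
    by (metis scaleC_of_real scaleC_scaleC scaleR_conv_of_real)
  show "a *\<^sub>C (r *\<^sub>R b) = r *\<^sub>R (a *\<^sub>C b)"
    by (metis mult.commute scaleC_of_real scaleC_scaleC)
  show "\<exists>K. \<forall>(a::complex) (b::'h). norm (a *\<^sub>C b) \<le> norm a * norm b * K"
    by (auto intro!: exI[of _ 1] simp: norm_scaleC)
qed

definition orthonormal :: "'a::complex_hilbert_space set \<Rightarrow> bool"
  where "orthonormal E \<longleftrightarrow> (\<forall>e\<in>E. \<forall>f\<in>E. cinner e f = (if e = f then 1 else 0))"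

definition proj :: "'a::complex_hilbert_space set \<Rightarrow> 'a \<Rightarrow> 'a"
  where "proj S h = (\<Sum>e\<in>S. cinner e h *\<^sub>C e)"

text \<open>A maximal orthonormal set is total, since a nonzero vector orthogonal to it could be
  normalised and added.\<close>

lemma orthonormal_basis_exists: "\<exists>E :: 'a::complex_hilbert_space set. orthonormal_basis E"
proof -
  have "\<exists>M\<in>{E :: 'a set. orthonormal E}. \<forall>Y\<in>{E. orthonormal E}. M \<subseteq> Y \<longrightarrow> Y = M"
  proof (rule subset_Zorn')
    fix C :: "'a set set" assume C: "subset.chain {E. orthonormal E} C"
    have "cinner e f = (if e = f then 1 else 0)" if "e \<in> \<Union>C" "f \<in> \<Union>C" for e f
    proof -
      from that obtain Y1 Y2 where Y12: "Y1 \<in> C" "e \<in> Y1" "Y2 \<in> C" "f \<in> Y2" by blast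
      moreover have "Y1 \<subseteq> Y2 \<or> Y2 \<subseteq> Y1"
        using C Y12 by (auto simp: subset.chain_def)
      ultimately obtain Y where "Y \<in> C" "e \<in> Y" "f \<in> Y" by blast
      then show ?thesis using C by (auto simp: subset.chain_def orthonormal_def)
    qed
    then show "\<Union>C \<in> {E. orthonormal E}" by (simp add: orthonormal_def)
  qed
  then obtain M :: "'a set" where M: "orthonormal M"
    and max: "\<And>Y. orthonormal Y \<Longrightarrow> M \<subseteq> Y \<Longrightarrow> Y = M"
    unfolding Bex_def Ball_def mem_Collect_eq by (elim exE conjE) simp
  have "h = 0" if h: "\<forall>e\<in>M. cinner e h = 0" for h
  proof (rule ccontr)
    assume "h \<noteq> 0"
    define u where "u = (1 / norm h) *\<^sub>R h"
    have u1: "cinner u u = 1"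
      using \<open>h \<noteq> 0\<close> by (simp add: cinner_self u_def)
    have uM: "cinner e u = 0" "cinner u e = 0" if "e \<in> M" for e
    proof -
      have "cinner e h = 0" "cinner h e = 0"
        using h that by (simp, metis cinner_commute complex_cnj_zero)
      then show "cinner e u = 0" "cinner u e = 0"
        by (simp_all add: u_def cinner_scaleR_right cinner_scaleR_left)
    qed
    have "orthonormal (insert u M)"
      using M u1 uM by (auto simp: orthonormal_def)
    then have "insert u M = M" by (rule max[OF _ subset_insertI])
    then have "u \<in> M" by auto
    then have "cinner u u = 0" by (rule uM)
    then show False using u1 by simp
  qed
  then have "orthonormal_basis M" using M unfolding orthonormal_basis_def orthonormal_def by simp
  then show ?thesis ..
qed

lemma cinner_proj:
  assumes "orthonormal S" "finite S" "e \<in> S"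
  shows "cinner e (proj S h) = cinner e h"
proof -
  have "cinner e (proj S h) = (\<Sum>f\<in>S. if f = e then cinner e h else 0)"
    unfolding proj_def cinner_sum_right cinner_scaleC_right
    using assms(1,3) by (intro sum.cong) (auto simp: orthonormal_def)
  then show ?thesis using assms(2,3) by simp
qed

lemma cinner_proj_orthogonal:
  assumes "\<And>f. f \<in> S \<Longrightarrow> cinner e f = 0"
  shows "cinner e (proj S h) = 0"
  unfolding proj_def cinner_sum_right cinner_scaleC_right using assms by simp

lemma norm_proj:
  assumes "orthonormal S" "finite S"
  shows "(norm (proj S h))\<^sup>2 = (\<Sum>e\<in>S. (norm (cinner e h))\<^sup>2)"
proof -
  have "cinner (proj S h) (proj S h) = (\<Sum>e\<in>S. cnj (cinner e h) * cinner e h)"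
    using cinner_proj[OF assms]
    by (subst proj_def) (simp add: cinner_sum_left cinner_scaleC_left)
  also have "\<dots> = of_real (\<Sum>e\<in>S. (norm (cinner e h))\<^sup>2)"
    by (simp add: complex_norm_square mult.commute del: of_real_power)
  finally show ?thesis by (metis cinner_self of_real_eq_iff)
qed

lemma cinner_proj_swap:
  assumes "finite S"
  shows "cinner (proj S u) v = cinner u (proj S v)"
proof -
  have "cnj (cinner e u) = cinner u e" for e by (metis cinner_commute)
  then show ?thesis
    by (simp add: proj_def cinner_sum_left cinner_sum_right cinner_scaleC_left cinner_scaleC_right
        mult.commute)
qed

lemma proj_Pythagoras:
  assumes "orthonormal S" "finite S"
  shows "(norm h)\<^sup>2 = (norm (proj S h))\<^sup>2 + (norm (h - proj S h))\<^sup>2"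
proof -
  have pp: "proj S (proj S h) = proj S h"
    unfolding proj_def[of S "proj S h"] using cinner_proj[OF assms] by (simp add: proj_def)
  have hp: "cinner h (proj S h) = cinner (proj S h) (proj S h)"
    using cinner_proj_swap[OF assms(2), of h "proj S h"] pp by simp
  then have ph: "cinner (proj S h) h = cinner (proj S h) (proj S h)"
    by (metis cinner_commute)
  have "cinner (h - proj S h) (h - proj S h) = cinner h h - cinner (proj S h) (proj S h)"
    by (simp add: cinner_diff_left cinner_diff_right hp ph)
  then have "(norm (h - proj S h))\<^sup>2 = (norm h)\<^sup>2 - (norm (proj S h))\<^sup>2"
    unfolding cinner_self of_real_diff[symmetric] of_real_eq_iff .
  then show ?thesis by simp
qed

lemma Bessel:
  assumes "orthonormal S" "finite S"
  shows "(\<Sum>e\<in>S. (norm (cinner e h))\<^sup>2) \<le> (norm h)\<^sup>2"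
  using proj_Pythagoras[OF assms, of h] norm_proj[OF assms, of h] by simp

lemma norm_proj_le:
  assumes "orthonormal S" "finite S"
  shows "norm (proj S h) \<le> norm h"
  by (rule power2_le_imp_le) (use Bessel[OF assms, of h] norm_proj[OF assms, of h] in auto)

lemma norm_proj_compl_le:
  assumes "orthonormal S" "finite S"
  shows "norm (h - proj S h) \<le> norm h"
  by (rule power2_le_imp_le) (use proj_Pythagoras[OF assms, of h] in auto)

lemma proj_diff: "proj S (u - v) = proj S u - proj S v"
  unfolding proj_def sum_subtractf[symmetric]
  by (intro sum.cong refl)
    (simp add: cinner_diff_right bounded_bilinear.diff_left[OF bounded_bilinear_scaleC])

lemma orthonormal_subset: "orthonormal E \<Longrightarrow> S \<subseteq> E \<Longrightarrow> orthonormal S"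
  unfolding orthonormal_def by (meson subsetD)

lemma proj_subset_diff:
  assumes "finite S'" "S \<subseteq> S'"
  shows "proj S' h = proj S h + proj (S' - S) h"
  unfolding proj_def using sum.subset_diff[OF assms(2,1)] by (simp add: add.commute)

text \<open>The projections onto larger and larger finite parts that nearly exhaust
  \<open>\<Sum>\<bar>\<langle>e,h\<rangle>\<bar>\<^sup>2\<close> form a Cauchy sequence. Its limit has the same
  coefficients as \<open>h\<close>, so it is \<open>h\<close> by totality.\<close>

lemma proj_approximates:
  fixes h :: "'a::complex_hilbert_space"
  assumes E: "orthonormal_basis E" and "\<epsilon> > 0"
  obtains S where "finite S" "S \<subseteq> E"
    "\<And>S'. finite S' \<Longrightarrow> S \<subseteq> S' \<Longrightarrow> S' \<subseteq> E \<Longrightarrow> norm (h - proj S' h) \<le> \<epsilon>"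
proof -
  have on: "orthonormal E" and total: "\<And>h. (\<forall>e\<in>E. cinner e h = 0) \<Longrightarrow> h = 0"
    using E by (auto simp: orthonormal_basis_def orthonormal_def)
  have onS: "orthonormal S" if "S \<subseteq> E" for S using on that by (rule orthonormal_subset)
  define \<phi> where "\<phi> S = (\<Sum>e\<in>S. (norm (cinner e h))\<^sup>2)" for S
  define \<F> where "\<F> = {S. finite S \<and> S \<subseteq> E}"
  define \<sigma> where "\<sigma> = (SUP S\<in>\<F>. \<phi> S)"
  have bdd: "bdd_above (\<phi> ` \<F>)"
    by (rule bdd_aboveI[of _ "(norm h)\<^sup>2"]) (auto simp: \<phi>_def \<F>_def intro!: Bessel onS)
  have upper: "\<phi> S \<le> \<sigma>" if "S \<in> \<F>" for S
    unfolding \<sigma>_def by (rule cSUP_upper[OF that bdd])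
  have "\<exists>S\<in>\<F>. \<sigma> - 1 / Suc n < \<phi> S" for n
    unfolding \<sigma>_def
    by (subst less_cSUP_iff[OF _ bdd, symmetric]) (auto simp: \<F>_def)
  then obtain T where T: "\<And>n. T n \<in> \<F>" and T_gt: "\<And>n. \<sigma> - 1 / Suc n < \<phi> (T n)"
    by metis
  define S where "S n = (\<Union>k\<le>n. T k)" for n
  have S: "S n \<in> \<F>" for n using T by (auto simp: S_def \<F>_def)
  have S_fin: "finite (S n)" "S n \<subseteq> E" for n using S[of n] by (auto simp: \<F>_def)
  have mono: "S m \<subseteq> S n" if "m \<le> n" for m n using that by (force simp: S_def)
  have S_gt: "\<sigma> - 1 / Suc n < \<phi> (S n)" for n
  proof -
    have "\<phi> (T n) \<le> \<phi> (S n)"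
      unfolding \<phi>_def using S_fin by (intro sum_mono2) (auto simp: S_def)
    then show ?thesis using T_gt[of n] by simp
  qed
  have tail: "\<phi> S' - \<phi> (S n) < 1 / Suc n" if "S' \<in> \<F>" for S' n
    using upper[OF that] S_gt[of n] by simp
  have dist2: "(norm (proj S' h - proj (S n) h))\<^sup>2 < 1 / Suc n" if "S' \<in> \<F>" "S n \<subseteq> S'" for S' n
  proof -
    have f: "finite S'" "S' \<subseteq> E" using that by (auto simp: \<F>_def)
    have "proj S' h - proj (S n) h = proj (S' - S n) h"
      using proj_subset_diff[OF f(1) that(2), where h = h] by simp
    then have "(norm (proj S' h - proj (S n) h))\<^sup>2 = \<phi> (S' - S n)"
      unfolding \<phi>_def using f by (simp add: norm_proj onS subset_iff)
    also have "\<dots> = \<phi> S' - \<phi> (S n)"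
      unfolding \<phi>_def using f that(2) by (simp add: sum_diff)
    finally show ?thesis using tail[OF that(1), of n] by simp
  qed
  have small: "\<exists>n. 1 / real (Suc n) < \<delta>" if "\<delta> > 0" for \<delta>
    using that nat_approx_posE by metis
  have "Cauchy (\<lambda>n. proj (S n) h)"
  proof (rule CauchyI')
    fix \<delta> :: real assume "\<delta> > 0"
    then obtain n where n: "1 / real (Suc n) < \<delta>\<^sup>2" using small[of "\<delta>\<^sup>2"] by auto
    show "\<exists>M. \<forall>m\<ge>M. \<forall>n>m. dist (proj (S m) h) (proj (S n) h) < \<delta>"
    proof (intro exI allI impI)
      fix m k :: nat assume m: "n \<le> m" and k: "m < k"
      have "1 / real (Suc m) \<le> 1 / real (Suc n)" using m by (simp add: field_simps)
      then have "(norm (proj (S k) h - proj (S m) h))\<^sup>2 < \<delta>\<^sup>2"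
        using dist2[OF S mono[of m k]] k n by fastforce
      then show "dist (proj (S m) h) (proj (S k) h) < \<delta>"
        using \<open>\<delta> > 0\<close> by (simp add: dist_norm norm_minus_commute power2_less_imp_less)
    qed
  qed
  then obtain h' where h': "(\<lambda>n. proj (S n) h) \<longlonglongrightarrow> h'"
    using convergent_eq_Cauchy by blast
  have "cinner e (h - h') = 0" if "e \<in> E" for e
  proof -
    have lim: "(\<lambda>n. cinner e (proj (S n) h)) \<longlonglongrightarrow> cinner e h'"
      by (intro bounded_bilinear.tendsto[OF bounded_bilinear_cinner] tendsto_const h')
    show ?thesis
    proof (cases "\<exists>k. e \<in> S k")
      case True
      then obtain k where "e \<in> S k" ..
      then have "\<forall>n\<ge>k. cinner e (proj (S n) h) = cinner e h"
        using mono onS S_fin by (auto intro!: cinner_proj)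
      then have "(\<lambda>n. cinner e (proj (S n) h)) \<longlonglongrightarrow> cinner e h"
        by (intro tendsto_eventually) (auto simp: eventually_sequentially)
      then show ?thesis using LIMSEQ_unique[OF lim] by (simp add: cinner_diff_right)
    next
      case False
      have "(norm (cinner e h))\<^sup>2 < 1 / Suc n" for n
      proof -
        have "insert e (S n) \<in> \<F>" using S[of n] that by (auto simp: \<F>_def)
        moreover have "\<phi> (insert e (S n)) = (norm (cinner e h))\<^sup>2 + \<phi> (S n)"
          using False S_fin by (simp add: \<phi>_def)
        ultimately show ?thesis using tail[of "insert e (S n)" n] by simp
      qed
      then have 0: "cinner e h = 0"
        using small[of "(norm (cinner e h))\<^sup>2"] by (metis less_asym zero_less_norm_iff zero_less_power)
      have "cinner e (proj (S n) h) = 0" for n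
        using False that on S_fin[of n]
        by (intro cinner_proj_orthogonal) (auto simp: orthonormal_def subset_iff)
      then have "cinner e h' = 0" using LIMSEQ_unique[OF lim] by simp
      then show ?thesis by (simp add: cinner_diff_right 0)
    qed
  qed
  then have "h' = h" using total[of "h - h'"] by simp
  with h' \<open>\<epsilon> > 0\<close> obtain n where n: "norm (proj (S n) h - h) < \<epsilon>"
    using LIMSEQ_D by blast
  have "norm (h - proj S' h) \<le> \<epsilon>" if S': "finite S'" "S n \<subseteq> S'" "S' \<subseteq> E" for S'
  proof -
    have "(norm (h - proj S' h))\<^sup>2 \<le> (norm (h - proj (S n) h))\<^sup>2"
    proof -
      have "\<phi> (S n) \<le> \<phi> S'" unfolding \<phi>_def using S' by (intro sum_mono2) auto
      then show ?thesis
        using proj_Pythagoras[OF onS[OF S'(3)] S'(1), of h]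
          proj_Pythagoras[OF onS[OF S_fin(2)[of n]] S_fin(1)[of n], of h]
          norm_proj[OF onS[OF S'(3)] S'(1), of h] norm_proj[OF onS[OF S_fin(2)[of n]] S_fin(1)[of n], of h]
        unfolding \<phi>_def by linarith
    qed
    then have "norm (h - proj S' h) \<le> norm (h - proj (S n) h)"
      by (rule power2_le_imp_le) simp
    then show ?thesis using n by (simp add: norm_minus_commute)
  qed
  then show thesis using that S_fin by blast
qed

text \<open>The image of \<open>f\<close> is totally bounded, and \<open>1 - P\<close> is a contraction for each projection
  \<open>P\<close>, so approximating the points of a finite net suffices.\<close>

lemma proj_approximates_compact:
  assumes E: "orthonormal_basis E" and J: "compact J" and f: "continuous_on J f" and "\<epsilon> > 0"
  shows "\<forall>\<^sub>F S in finite_subsets_at_top E. \<forall>y\<in>J. norm (f y - proj S (f y)) \<le> \<epsilon>"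
proof -
  have on: "orthonormal E" using E by (auto simp: orthonormal_basis_def orthonormal_def)
  have "compact (f ` J)" using f J by (rule compact_continuous_image)
  then obtain N where N: "finite N" "f ` J \<subseteq> (\<Union>u\<in>N. ball u (\<epsilon> / 2))"
    using compact_eq_totally_bounded[of "f ` J"] \<open>\<epsilon> > 0\<close> half_gt_zero by blast
  have "\<forall>u\<in>N. \<exists>S. finite S \<and> S \<subseteq> E \<and> (\<forall>S'. finite S' \<longrightarrow> S \<subseteq> S' \<longrightarrow> S' \<subseteq> E \<longrightarrow>
      norm (u - proj S' u) \<le> \<epsilon> / 2)"
    using proj_approximates[OF E, of "\<epsilon> / 2"] \<open>\<epsilon> > 0\<close> by (metis half_gt_zero)
  then obtain S where S: "\<And>u. u \<in> N \<Longrightarrow> finite (S u) \<and> S u \<subseteq> E"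
    and S_close: "\<And>u S'. u \<in> N \<Longrightarrow> finite S' \<Longrightarrow> S u \<subseteq> S' \<Longrightarrow> S' \<subseteq> E \<Longrightarrow> norm (u - proj S' u) \<le> \<epsilon> / 2"
    by metis
  show ?thesis
    unfolding eventually_finite_subsets_at_top
  proof (intro exI[of _ "\<Union>u\<in>N. S u"] conjI allI impI ballI)
    show "finite (\<Union>u\<in>N. S u)" "(\<Union>u\<in>N. S u) \<subseteq> E" using N S by auto
    fix S' y assume S': "finite S' \<and> (\<Union>u\<in>N. S u) \<subseteq> S' \<and> S' \<subseteq> E" and "y \<in> J"
    then obtain u where u: "u \<in> N" "norm (f y - u) < \<epsilon> / 2"
      using N by (force simp: dist_norm norm_minus_commute)
    have "norm ((f y - u) - proj S' (f y - u)) \<le> norm (f y - u)"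
      using S' on by (intro norm_proj_compl_le) (auto intro: orthonormal_subset)
    moreover have "norm (u - proj S' u) \<le> \<epsilon> / 2" using S_close[OF u(1)] S' u(1) by blast
    moreover have "norm (f y - proj S' (f y)) = norm (((f y - u) - proj S' (f y - u)) + (u - proj S' u))"
      by (simp add: proj_diff)
    ultimately show "norm (f y - proj S' (f y)) \<le> \<epsilon>"
      using u(2) norm_triangle_ineq[of "(f y - u) - proj S' (f y - u)" "u - proj S' u"] by linarith
  qed
qed

section \<open>Determinants indexed by a finite set\<close>

text \<open>The principal minors of an operator are the case of its matrix entries; other matrices
  arise by replacing a column.\<close>

definition gdet :: "'a set \<Rightarrow> ('a \<Rightarrow> 'a \<Rightarrow> complex) \<Rightarrow> complex"
  where "gdet S m = (\<Sum>p | p permutes S. of_int (sign p) * (\<Prod>i\<in>S. m i (p i)))"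

lemma principal_minor_gdet: "principal_minor T S = gdet S (\<lambda>e f. cinner e (T f))"
  by (simp add: principal_minor_def gdet_def)

lemma gdet_cong:
  assumes "\<And>i j. i \<in> S \<Longrightarrow> j \<in> S \<Longrightarrow> m i j = m' i j"
  shows "gdet S m = gdet S m'"
  unfolding gdet_def using assms by (intro sum.cong prod.cong arg_cong2[of _ _ _ _ "(*)"] refl)
    (auto simp: permutes_in_image)

text \<open>Expanding the product over \<open>e\<close> chooses the set \<open>F\<close> of indices where the second
  summand is taken; the identity contributes only if the permutation fixes all other indices.\<close>

lemma gdet_identity_plus:
  assumes "finite S"
  shows "gdet S (\<lambda>i j. (if i = j then 1 else 0) + k i j) = (\<Sum>F\<in>Pow S. gdet F k)"
proof -
  have "gdet S (\<lambda>i j. (if i = j then 1 else 0) + k i j)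
      = (\<Sum>p | p permutes S. \<Sum>F\<in>Pow S. of_int (sign p) *
          ((\<Prod>i\<in>F. k i (p i)) * (\<Prod>i\<in>S - F. if i = p i then 1 else 0)))"
    unfolding gdet_def sum_distrib_left[symmetric]
    using prod_add[OF assms, of "\<lambda>i. k i (p i)" "\<lambda>i. if i = p i then 1 else 0" for p]
    by (simp add: add.commute)
  also have "\<dots> = (\<Sum>F\<in>Pow S. \<Sum>p | p permutes S. of_int (sign p) *
          ((\<Prod>i\<in>F. k i (p i)) * (\<Prod>i\<in>S - F. if i = p i then 1 else 0)))"
    by (rule sum.swap)
  also have "\<dots> = (\<Sum>F\<in>Pow S. gdet F k)"
  proof (rule sum.cong[OF refl])
    fix F assume "F \<in> Pow S"
    then have F: "F \<subseteq> S" "finite F" using assms finite_subset by auto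
    show "(\<Sum>p | p permutes S. of_int (sign p) *
          ((\<Prod>i\<in>F. k i (p i)) * (\<Prod>i\<in>S - F. if i = p i then 1 else 0))) = gdet F k"
      unfolding gdet_def
    proof (rule sum.mono_neutral_cong_right)
      show "finite {p. p permutes S}" using assms by (rule finite_permutations)
      show "{p. p permutes F} \<subseteq> {p. p permutes S}" using F permutes_subset by blast
      show "\<forall>p\<in>{p. p permutes S} - {p. p permutes F}. of_int (sign p) *
          ((\<Prod>i\<in>F. k i (p i)) * (\<Prod>i\<in>S - F. if i = p i then 1 else 0)) = 0"
      proof
        fix p assume p: "p \<in> {p. p permutes S} - {p. p permutes F}"
        then have "\<exists>i\<in>S - F. p i \<noteq> i" using permutes_superset[of p S F] by auto
        then have "(\<Prod>i\<in>S - F. if i = p i then 1 else 0 :: complex) = 0"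
          using assms by (intro prod_zero) (auto, metis DiffI)
        then show "of_int (sign p) *
          ((\<Prod>i\<in>F. k i (p i)) * (\<Prod>i\<in>S - F. if i = p i then 1 else 0)) = 0" by simp
      qed
      show "of_int (sign p) * ((\<Prod>i\<in>F. k i (p i)) * (\<Prod>i\<in>S - F. if i = p i then 1 else 0)) =
          of_int (sign p) * (\<Prod>i\<in>F. k i (p i))" if "p \<in> {p. p permutes F}" for p
      proof -
        have "(\<Prod>i\<in>S - F. if i = p i then 1 else 0 :: complex) = 1"
          using that by (intro prod.neutral) (auto simp: permutes_not_in)
        then show ?thesis by simp
      qed
    qed
  qed
  finally show ?thesis .
qed

lemma gdet_identity:
  assumes "finite S"
  shows "gdet S (\<lambda>i j. if i = j then 1 else 0) = 1"
proof -
  have "gdet S (\<lambda>i j. if i = j then 1 else 0) = (\<Sum>F\<in>Pow S. gdet F (\<lambda>i j. 0))"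
    using gdet_identity_plus[OF assms, of "\<lambda>i j. 0"] by simp
  also have "\<dots> = (\<Sum>F\<in>Pow S. if F = {} then 1 else 0)"
  proof (rule sum.cong[OF refl])
    fix F assume "F \<in> Pow S"
    then have "finite F" using assms finite_subset by auto
    then show "gdet F (\<lambda>i j. 0) = (if F = {} then 1 else 0)"
      by (auto simp: gdet_def power_0_left card_eq_0_iff)
  qed
  also have "\<dots> = 1" using assms by simp
  finally show ?thesis .
qed

abbreviation replace_col :: "('a \<Rightarrow> 'a \<Rightarrow> complex) \<Rightarrow> 'a \<Rightarrow> ('a \<Rightarrow> complex) \<Rightarrow> 'a \<Rightarrow> 'a \<Rightarrow> complex"
  where "replace_col m f c \<equiv> (\<lambda>i j. if j = f then c i else m i j)"

lemma sum_gdet_replace_col: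
  assumes "finite S"
  shows "(\<Sum>f\<in>S. w f * gdet S (replace_col m f c)) =
    (\<Sum>p | p permutes S. of_int (sign p) * (\<Sum>i\<in>S. c i * w (p i) * (\<Prod>j\<in>S - {i}. m j (p j))))"
proof -
  have "(\<Sum>f\<in>S. w f * (\<Prod>j\<in>S. replace_col m f c j (p j))) =
      (\<Sum>i\<in>S. c i * w (p i) * (\<Prod>j\<in>S - {i}. m j (p j)))" if p: "p permutes S" for p
  proof -
    have "(\<Sum>f\<in>S. w f * (\<Prod>j\<in>S. replace_col m f c j (p j))) =
        (\<Sum>i\<in>S. w (p i) * (\<Prod>j\<in>S. replace_col m (p i) c j (p j)))"
      by (rule sum.reindex_bij_betw[symmetric, OF permutes_imp_bij[OF p]])
    also have "\<dots> = (\<Sum>i\<in>S. c i * w (p i) * (\<Prod>j\<in>S - {i}. m j (p j)))"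
    proof (rule sum.cong[OF refl])
      fix i assume "i \<in> S"
      have "(\<Prod>j\<in>S. replace_col m (p i) c j (p j))
          = c i * (\<Prod>j\<in>S - {i}. replace_col m (p i) c j (p j))"
        using prod.remove[OF assms \<open>i \<in> S\<close>, of "\<lambda>j. replace_col m (p i) c j (p j)"] by simp
      also have "(\<Prod>j\<in>S - {i}. replace_col m (p i) c j (p j)) = (\<Prod>j\<in>S - {i}. m j (p j))"
        using permutes_inj[OF p] by (intro prod.cong) (auto dest: injD)
      finally show "w (p i) * (\<Prod>j\<in>S. replace_col m (p i) c j (p j))
          = c i * w (p i) * (\<Prod>j\<in>S - {i}. m j (p j))" by simp
    qed
    finally show ?thesis .
  qed
  then have "(\<Sum>p | p permutes S. of_int (sign p) * (\<Sum>f\<in>S. w f * (\<Prod>j\<in>S. replace_col m f c j (p j)))) =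
    (\<Sum>p | p permutes S. of_int (sign p) * (\<Sum>i\<in>S. c i * w (p i) * (\<Prod>j\<in>S - {i}. m j (p j))))"
    by (intro sum.cong) auto
  then show ?thesis
    unfolding gdet_def sum_distrib_left
    by (subst sum.swap) (simp add: mult.left_commute)
qed

text \<open>Cramer's rule. Sorting the terms by the row \<open>i\<close> of the entry of \<open>c\<close>, the row \<open>i = e\<close>
  gives the determinant; for \<open>i \<noteq> e\<close> the row \<open>e\<close> occurs twice and the terms cancel in pairs
  under composition with the transposition of \<open>i\<close> and \<open>e\<close>.\<close>

lemma gdet_Cramer:
  assumes "finite S" "e \<in> S"
  shows "(\<Sum>f\<in>S. m e f * gdet S (replace_col m f c)) = gdet S m * c e"
proof -
  \<comment> \<open>The terms in which the entry of \<open>c\<close> comes from row \<open>i\<close>.\<close>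
  define g where "g i p = of_int (sign p) * (m e (p i) * (\<Prod>j\<in>S - {i}. m j (p j)))" for i p
  have "(\<Sum>p | p permutes S. g i p) = (if i = e then gdet S m else 0)" if "i \<in> S" for i
  proof (cases "i = e")
    case True
    then show ?thesis
      using prod.remove[OF assms, of "\<lambda>j. m j (p j)" for p] by (simp add: g_def gdet_def)
  next
    case False
    let ?t = "Transposition.transpose i e"
    have t: "?t permutes S" using that assms(2) by (simp add: permutes_swap_id)
    have split: "g i p = of_int (sign p) * (m e (p i) * (m e (p e) * (\<Prod>j\<in>S - {i} - {e}. m j (p j))))" for p
      unfolding g_def using prod.remove[of "S - {i}" e "\<lambda>j. m j (p j)"] assms False by simp
    have "g i (p \<circ> ?t) = - g i p" if p: "p permutes S" for p
    proof -
      have "permutation p" "permutation ?t"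
        using p t assms(1) permutation_permutes by blast+
      then have "sign (p \<circ> ?t) = - sign p" using False by (simp add: sign_compose sign_swap_id)
      moreover have "(\<Prod>j\<in>S - {i} - {e}. m j (p (?t j))) = (\<Prod>j\<in>S - {i} - {e}. m j (p j))"
        by (intro prod.cong) (auto simp: Transposition.transpose_def)
      ultimately show ?thesis unfolding split by simp
    qed
    then have neg: "(\<Sum>p | p permutes S. g i (p \<circ> ?t)) = - (\<Sum>p | p permutes S. g i p)"
      by (simp flip: sum_negf)
    moreover have "(\<Sum>p | p permutes S. g i (p \<circ> ?t)) = (\<Sum>p | p permutes S. g i p)"
      by (rule sum.reindex_bij_witness[where i = "\<lambda>p. p \<circ> ?t" and j = "\<lambda>p. p \<circ> ?t"])
        (auto simp: o_assoc[symmetric] intro: permutes_compose[OF t])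
    ultimately have "(\<Sum>p | p permutes S. g i p) = - (\<Sum>p | p permutes S. g i p)"
      by simp
    then show ?thesis using False by simp
  qed
  then have "(\<Sum>i\<in>S. c i * (\<Sum>p | p permutes S. g i p)) = (\<Sum>i\<in>S. if i = e then c e * gdet S m else 0)"
    by (intro sum.cong) auto
  also have "\<dots> = gdet S m * c e" using assms by simp
  finally show ?thesis
    unfolding sum_gdet_replace_col[OF assms(1)] g_def sum_distrib_left
    by (subst sum.swap) (simp add: mult_ac)
qed

text \<open>Jacobi's formula for a rank one derivative.\<close>

lemma gdet_has_vector_derivative:
  assumes "finite S"
    and "\<And>i j. i \<in> S \<Longrightarrow> j \<in> S \<Longrightarrow> ((\<lambda>y. m y i j) has_vector_derivative c i * w j) (at x within J)"
  shows "((\<lambda>y. gdet S (m y)) has_vector_derivative (\<Sum>f\<in>S. w f * gdet S (replace_col (m x) f c)))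
    (at x within J)"
proof -
  have "((\<lambda>y. \<Prod>i\<in>S. m y i (p i)) has_vector_derivative
      (\<Sum>i\<in>S. c i * w (p i) * (\<Prod>j\<in>S - {i}. m x j (p j)))) (at x within J)"
    if "p permutes S" for p
  proof -
    have "((\<lambda>y. \<Prod>i\<in>S. m y i (p i)) has_derivative
        (\<lambda>h. \<Sum>i\<in>S. h *\<^sub>R (c i * w (p i)) * (\<Prod>j\<in>S - {i}. m x j (p j)))) (at x within J)"
      using assms(2) that unfolding has_vector_derivative_def
      by (intro has_derivative_prod) (auto simp: permutes_in_image)
    then show ?thesis
      by (simp add: has_vector_derivative_def scaleR_sum_right)
  qed
  then show ?thesis
    unfolding sum_gdet_replace_col[OF assms(1)] unfolding gdet_def
    by (intro has_vector_derivative_sum has_vector_derivative_mult_right) auto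
qed

section \<open>Absolute convergence of the Fredholm expansion\<close>

text \<open>For \<open>r = 0\<close> this dominates the sum of the minors over all \<open>F \<subseteq> S\<close>. The parameter \<open>r\<close>
  makes the sum recursive in \<open>S\<close>.\<close>

definition fact_weight :: "('a \<Rightarrow> real) \<Rightarrow> nat \<Rightarrow> 'a set \<Rightarrow> real"
  where "fact_weight s r S = (\<Sum>F\<in>Pow S. fact (card F + r) * (\<Prod>e\<in>F. s e))"

lemma fact_weight_insert:
  assumes "finite S" "e \<notin> S"
  shows "fact_weight s r (insert e S) = fact_weight s r S + s e * fact_weight s (Suc r) S"
proof -
  have inj: "inj_on (insert e) (Pow S)" using assms(2) by (auto simp: inj_on_def)
  have "fact_weight s r (insert e S) = fact_weight s r S
      + (\<Sum>F\<in>insert e ` Pow S. fact (card F + r) * (\<Prod>e\<in>F. s e))"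
    unfolding fact_weight_def Pow_insert using assms by (subst sum.union_disjoint) auto
  also have "(\<Sum>F\<in>insert e ` Pow S. fact (card F + r) * (\<Prod>e\<in>F. s e))
      = (\<Sum>F\<in>Pow S. s e * (fact (card F + Suc r) * (\<Prod>e\<in>F. s e)))"
    unfolding sum.reindex[OF inj] o_def
  proof (rule sum.cong[OF refl])
    fix F assume "F \<in> Pow S"
    then have "finite F" "e \<notin> F" using assms finite_subset by auto
    then show "fact (card (insert e F) + r) * (\<Prod>e\<in>insert e F. s e) =
        s e * (fact (card F + Suc r) * (\<Prod>e\<in>F. s e))"
      by simp
  qed
  finally show ?thesis by (simp add: fact_weight_def sum_distrib_left)
qed

text \<open>The bound is \<open>\<Sum>\<^sub>k (k+r)!/k! \<sigma>\<^sup>k\<close> with \<open>\<sigma> = \<Sum>s\<close>. In the induction, convexity of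
  \<open>r!/(1-\<sigma>)\<^sup>r\<^sup>+\<^sup>1\<close> in \<open>\<sigma>\<close> absorbs the term of the new index, because
  the bound for \<open>r + 1\<close> is the derivative of the bound for \<open>r\<close>.\<close>

lemma fact_weight_small:
  assumes "finite S" "\<And>e. e \<in> S \<Longrightarrow> 0 \<le> s e" "(\<Sum>e\<in>S. s e) < 1"
  shows "fact_weight s r S \<le> fact r / (1 - (\<Sum>e\<in>S. s e)) ^ Suc r"
  using assms
proof (induction S arbitrary: r rule: finite_induct)
  case empty
  then show ?case by (simp add: fact_weight_def)
next
  case (insert e S)
  define u where "u = 1 - (\<Sum>e\<in>S. s e)"
  have s: "0 \<le> s e" and us: "0 < u - s e" using insert.prems insert.hyps by (auto simp: u_def)
  then have u: "0 < u" by linarith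
  define t where "t = s e / u"
  have t: "0 \<le> t" "t < 1" using s us u by (auto simp: t_def)
  have IH: "fact_weight s r S \<le> fact r / u ^ Suc r" for r
  proof -
    have "sum s S < 1" using u by (simp add: u_def)
    then show ?thesis unfolding u_def using insert.IH[of r] insert.prems by blast
  qed
  have "fact_weight s r (insert e S) \<le> fact r / u ^ Suc r + s e * (fact (Suc r) / u ^ Suc (Suc r))"
    unfolding fact_weight_insert[OF insert.hyps] using s IH by (intro add_mono mult_left_mono)
  also have "\<dots> = fact r / u ^ Suc r * (1 + real (Suc r) * t)"
    using u by (simp add: t_def field_simps)
  also have "\<dots> \<le> fact r / u ^ Suc r * (1 / (1 - t) ^ Suc r)"
  proof (rule mult_left_mono)
    have "(1 + real (Suc r) * t) * (1 - t) ^ Suc r \<le> (1 + t) ^ Suc r * (1 - t) ^ Suc r"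
      using Bernoulli_inequality[of t "Suc r"] t by (intro mult_right_mono) auto
    also have "\<dots> = (1 - t\<^sup>2) ^ Suc r"
      unfolding power_mult_distrib[symmetric] by (simp add: algebra_simps power2_eq_square)
    also have "\<dots> \<le> 1" using t by (intro power_le_one) (auto simp: power_le_one)
    finally show "1 + real (Suc r) * t \<le> 1 / (1 - t) ^ Suc r"
      using t by (simp add: field_simps)
  qed (use u in auto)
  also have "\<dots> = fact r / (u * (1 - t)) ^ Suc r" by (simp only: power_mult_distrib times_divide_times_eq mult_1_right)
  also have "u * (1 - t) = u - s e" using u by (simp add: t_def field_simps)
  also have "u - s e = 1 - (\<Sum>e\<in>insert e S. s e)" using insert.hyps by (simp add: u_def)
  finally show ?case .
qed

text \<open>Finitely many indices can be split off, so that the remaining \<open>s e\<close> have sum at most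
  \<open>1/2\<close>; each index split off raises \<open>r\<close> by at most one.\<close>

lemma fact_weight_bounded:
  fixes s :: "'a \<Rightarrow> real"
  assumes nonneg: "\<And>e. e \<in> E \<Longrightarrow> 0 \<le> s e"
    and bound: "\<And>S. finite S \<Longrightarrow> S \<subseteq> E \<Longrightarrow> (\<Sum>e\<in>S. s e) \<le> t"
  shows "\<exists>C. \<forall>S. finite S \<longrightarrow> S \<subseteq> E \<longrightarrow> fact_weight s r S \<le> C"
proof -
  define \<F> where "\<F> = {S. finite S \<and> S \<subseteq> E}"
  have bdd: "bdd_above (sum s ` \<F>)" by (rule bdd_aboveI[of _ t]) (auto simp: \<F>_def bound)
  have "\<exists>S\<in>\<F>. (SUP S\<in>\<F>. sum s S) - 1/2 < sum s S"
    by (subst less_cSUP_iff[OF _ bdd, symmetric]) (auto simp: \<F>_def)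
  then obtain S0 where S0: "S0 \<in> \<F>" "(SUP S\<in>\<F>. sum s S) - 1/2 < sum s S0" by blast
  have tail: "sum s S \<le> 1/2" if "finite S" "S \<subseteq> E - S0" for S
  proof -
    have "sum s (S0 \<union> S) \<le> (SUP S\<in>\<F>. sum s S)"
      using S0 that by (intro cSUP_upper[OF _ bdd]) (auto simp: \<F>_def)
    moreover have "sum s (S0 \<union> S) = sum s S0 + sum s S"
      using S0 that by (intro sum.union_disjoint) (auto simp: \<F>_def)
    ultimately show ?thesis using S0(2) by simp
  qed
  have "finite T \<Longrightarrow> T \<subseteq> S0 \<Longrightarrow>
      \<exists>C. \<forall>S. finite S \<longrightarrow> S \<subseteq> E - S0 \<longrightarrow> fact_weight s r (T \<union> S) \<le> C" for T r
  proof (induction T arbitrary: r rule: finite_induct)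
    case empty
    have "fact_weight s r S \<le> fact r / (1/2) ^ Suc r" if "finite S" "S \<subseteq> E - S0" for S
    proof -
      have "fact_weight s r S \<le> fact r / (1 - sum s S) ^ Suc r"
        using that nonneg tail[OF that] by (intro fact_weight_small) auto
      also have "\<dots> \<le> fact r / (1/2) ^ Suc r"
        using tail[OF that] by (intro divide_left_mono power_mono mult_pos_pos zero_less_power) auto
      finally show ?thesis .
    qed
    then show ?case by auto
  next
    case (insert e T)
    obtain C1 where C1: "\<And>S. finite S \<Longrightarrow> S \<subseteq> E - S0 \<Longrightarrow> fact_weight s r (T \<union> S) \<le> C1"
      using insert.IH[of r] insert.prems by auto
    obtain C2 where C2: "\<And>S. finite S \<Longrightarrow> S \<subseteq> E - S0 \<Longrightarrow> fact_weight s (Suc r) (T \<union> S) \<le> C2"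
      using insert.IH[of "Suc r"] insert.prems by auto
    have e: "e \<in> E" "e \<in> S0" using insert.prems S0 by (auto simp: \<F>_def)
    have "fact_weight s r (insert e T \<union> S) \<le> C1 + s e * C2" if "finite S" "S \<subseteq> E - S0" for S
    proof -
      have "finite (T \<union> S)" "e \<notin> T \<union> S" using insert.hyps that e by auto
      from fact_weight_insert[OF this, of s r] show ?thesis
        using C1[OF that] mult_left_mono[OF C2[OF that] nonneg[OF e(1)]] by simp
    qed
    then show ?case by blast
  qed
  from this[of S0 r] obtain C
    where C: "\<And>S. finite S \<Longrightarrow> S \<subseteq> E - S0 \<Longrightarrow> fact_weight s r (S0 \<union> S) \<le> C"
    using S0 by (auto simp: \<F>_def)
  have "fact_weight s r S \<le> C" if S: "finite S" "S \<subseteq> E" for S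
  proof -
    have "fact_weight s r S \<le> fact_weight s r (S0 \<union> (S - S0))"
      unfolding fact_weight_def using S S0 nonneg
      by (intro sum_mono2) (auto simp: \<F>_def intro!: mult_nonneg_nonneg prod_nonneg)
    also have "\<dots> \<le> C" using S by (intro C) auto
    finally show ?thesis .
  qed
  then show ?thesis by blast
qed

text \<open>All terms of the Leibniz formula obey the same bound, since a permutation only reorders the
  factors \<open>\<beta>\<close>.\<close>

lemma norm_gdet_le:
  assumes "finite F" and "\<And>e. e \<in> F \<Longrightarrow> 0 \<le> \<alpha> e \<and> 0 \<le> \<beta> e"
    and "\<And>e f. e \<in> F \<Longrightarrow> f \<in> F \<Longrightarrow> norm (k e f) \<le> \<alpha> e * \<beta> f"
  shows "norm (gdet F k) \<le> fact (card F) * (\<Prod>e\<in>F. \<alpha> e * \<beta> e)"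
proof -
  have "norm (of_int (sign p) * (\<Prod>e\<in>F. k e (p e))) \<le> (\<Prod>e\<in>F. \<alpha> e * \<beta> e)" if p: "p permutes F" for p
  proof -
    have "norm (of_int (sign p) * (\<Prod>e\<in>F. k e (p e))) = (\<Prod>e\<in>F. norm (k e (p e)))"
      by (simp add: norm_mult prod_norm sign_def)
    also have "\<dots> \<le> (\<Prod>e\<in>F. \<alpha> e * \<beta> (p e))"
      using assms(3) p by (intro prod_mono) (auto simp: permutes_in_image)
    also have "\<dots> = (\<Prod>e\<in>F. \<alpha> e) * (\<Prod>e\<in>F. \<beta> (p e))" by (rule prod.distrib)
    also have "(\<Prod>e\<in>F. \<beta> (p e)) = (\<Prod>e\<in>F. \<beta> e)"
      by (rule prod.reindex_bij_betw[OF permutes_imp_bij[OF p]])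
    finally show ?thesis by (simp add: prod.distrib)
  qed
  then have "norm (gdet F k) \<le> (\<Sum>p | p permutes F. \<Prod>e\<in>F. \<alpha> e * \<beta> e)"
    unfolding gdet_def by (intro sum_norm_le) auto
  also have "\<dots> = fact (card F) * (\<Prod>e\<in>F. \<alpha> e * \<beta> e)"
    using assms(1) by (simp add: card_permutations)
  finally show ?thesis .
qed

lemma gdet_summable:
  assumes nonneg: "\<And>e. e \<in> E \<Longrightarrow> 0 \<le> \<alpha> e \<and> 0 \<le> \<beta> e"
    and k: "\<And>e f. e \<in> E \<Longrightarrow> f \<in> E \<Longrightarrow> norm (k e f) \<le> \<alpha> e * \<beta> f"
    and trace: "\<And>S. finite S \<Longrightarrow> S \<subseteq> E \<Longrightarrow> (\<Sum>e\<in>S. \<alpha> e * \<beta> e) \<le> t"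
  shows "(\<lambda>F. gdet F k) summable_on {F. finite F \<and> F \<subseteq> E}"
proof -
  obtain C where C: "\<And>S. finite S \<Longrightarrow> S \<subseteq> E \<Longrightarrow> fact_weight (\<lambda>e. \<alpha> e * \<beta> e) 0 S \<le> C"
    using fact_weight_bounded[of E "\<lambda>e. \<alpha> e * \<beta> e" t 0] nonneg trace by auto
  have "(\<lambda>F. norm (gdet F k)) summable_on {F. finite F \<and> F \<subseteq> E}"
  proof (rule nonneg_bdd_above_summable_on)
    show "bdd_above (sum (\<lambda>F. norm (gdet F k)) ` {Y. Y \<subseteq> {F. finite F \<and> F \<subseteq> E} \<and> finite Y})"
    proof (rule bdd_aboveI2)
      fix Y assume "Y \<in> {Y. Y \<subseteq> {F. finite F \<and> F \<subseteq> E} \<and> finite Y}"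
      then have S: "finite (\<Union>Y)" "\<Union>Y \<subseteq> E" by auto
      have *: "norm (gdet F k) \<le> fact (card F + 0) * (\<Prod>e\<in>F. \<alpha> e * \<beta> e)"
        if "F \<in> Pow (\<Union>Y)" for F
      proof -
        have "finite F" "F \<subseteq> E" using that S finite_subset by auto
        then show ?thesis using nonneg k unfolding add_0_right by (intro norm_gdet_le) blast+
      qed
      have "(\<Sum>F\<in>Y. norm (gdet F k)) \<le> (\<Sum>F\<in>Pow (\<Union>Y). norm (gdet F k))"
        using S by (intro sum_mono2) auto
      also have "\<dots> \<le> fact_weight (\<lambda>e. \<alpha> e * \<beta> e) 0 (\<Union>Y)"
        unfolding fact_weight_def by (intro sum_mono *)
      also have "\<dots> \<le> C" by (rule C[OF S])
      finally show "(\<Sum>F\<in>Y. norm (gdet F k)) \<le> C" .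
    qed
  qed auto
  then show ?thesis by (rule abs_summable_summable)
qed

text \<open>Absolute convergence permits regrouping: the sum over all finite \<open>F\<close> is the Fredholm
  determinant when sorted by \<open>card F\<close>, and the limit of the finite determinants when the \<open>F\<close> are
  taken inside an increasing finite part of the basis.\<close>

lemma fredholm_det_limit:
  fixes N :: "'h::complex_hilbert_space \<Rightarrow> 'h"
  defines "E \<equiv> SOME E :: 'h set. orthonormal_basis E"
  assumes summable: "(\<lambda>F. principal_minor (\<lambda>h. N h - h) F) summable_on {F. finite F \<and> F \<subseteq> E}"
  shows "((\<lambda>S. principal_minor N S) \<longlongrightarrow> fredholm_det N) (finite_subsets_at_top E)"
proof -
  define m where "m F = principal_minor (\<lambda>h. N h - h) F" for F
  define \<F> where "\<F> = {F. finite F \<and> F \<subseteq> E}"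
  define \<F>k where "\<F>k k = {F. F \<subseteq> E \<and> finite F \<and> card F = k}" for k
  obtain \<tau> where \<tau>: "(m has_sum \<tau>) \<F>"
    using summable unfolding m_def \<F>_def summable_on_def by blast
  have "((\<lambda>(k, F). m F) has_sum \<tau>) (Sigma UNIV \<F>k) \<longleftrightarrow> (m has_sum \<tau>) \<F>"
    by (rule has_sum_reindex_bij_witness[where i = "\<lambda>F. (card F, F)" and j = snd])
      (auto simp: \<F>_def \<F>k_def)
  with \<tau> have sig: "((\<lambda>(k, F). m F) has_sum \<tau>) (Sigma UNIV \<F>k)" by simp
  have "m summable_on \<F>k k" for k
    by (rule summable_on_subset_banach[of _ \<F>])
      (use \<tau> in \<open>auto simp: summable_on_def \<F>_def \<F>k_def\<close>)
  then have "((\<lambda>k. \<Sum>\<^sub>\<infinity>F\<in>\<F>k k. m F) has_sum \<tau>) UNIV"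
    by (intro has_sum_SigmaD[OF sig]) (simp add: has_sum_infsum)
  then have "(\<lambda>k. \<Sum>\<^sub>\<infinity>F\<in>\<F>k k. m F) sums \<tau>" by (rule has_sum_imp_sums)
  then have det: "fredholm_det N = \<tau>"
    unfolding fredholm_det_def trace_ext_power_def Let_def E_def[symmetric] m_def \<F>k_def
    by (rule sums_unique[symmetric])
  have "filterlim Pow (finite_subsets_at_top \<F>) (finite_subsets_at_top E)"
    unfolding filterlim_finite_subsets_at_top
  proof (intro allI impI)
    fix Y assume Y: "finite Y \<and> Y \<subseteq> \<F>"
    have "finite (\<Union>Y)" "\<Union>Y \<subseteq> E" using Y by (auto simp: \<F>_def)
    then show "\<forall>\<^sub>F S in finite_subsets_at_top E. finite (Pow S) \<and> Y \<subseteq> Pow S \<and> Pow S \<subseteq> \<F>"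
      unfolding eventually_finite_subsets_at_top
      by (intro exI[of _ "\<Union>Y"]) (auto simp: \<F>_def dest: finite_subset)
  qed
  then have lim: "((\<lambda>S. \<Sum>F\<in>Pow S. m F) \<longlongrightarrow> \<tau>) (finite_subsets_at_top E)"
    using \<tau> unfolding has_sum_def by (rule filterlim_compose[rotated])
  have "orthonormal_basis E" unfolding E_def by (rule someI_ex[OF orthonormal_basis_exists])
  then have on: "orthonormal E" unfolding orthonormal_basis_def orthonormal_def by blast
  have "(\<Sum>F\<in>Pow S. m F) = principal_minor N S" if S: "finite S" "S \<subseteq> E" for S
  proof -
    have "(\<Sum>F\<in>Pow S. m F)
        = gdet S (\<lambda>e f. (if e = f then 1 else 0) + cinner e (N f - f))"
      unfolding m_def principal_minor_gdet by (rule gdet_identity_plus[symmetric, OF S(1)])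
    also have "\<dots> = gdet S (\<lambda>e f. cinner e (N f))"
      using on S(2) by (intro gdet_cong) (auto simp: orthonormal_def cinner_diff_right subset_iff)
    finally show ?thesis by (simp add: principal_minor_gdet)
  qed
  then have "\<forall>\<^sub>F S in finite_subsets_at_top E. (\<Sum>F\<in>Pow S. m F) = principal_minor N S"
    by (simp add: eventually_finite_subsets_at_top_weakI)
  then show ?thesis using lim unfolding det by (rule Lim_transform_eventually[rotated])
qed

section \<open>The vessel in terms of the first column of B\<close>

lemma norm_diff_le_derivative_bound:
  fixes f :: "real \<Rightarrow> 'a::real_normed_vector"
  assumes "\<And>x. x \<in> {p..q} \<Longrightarrow> (f has_vector_derivative f' x) (at x within {p..q})"
    and "\<And>x. x \<in> {p..q} \<Longrightarrow> norm (f' x) \<le> K"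
    and "y \<in> {p..q}" "z \<in> {p..q}"
  shows "norm (f y - f z) \<le> K * \<bar>y - z\<bar>"
proof -
  have "onorm (\<lambda>h. h *\<^sub>R f' x) \<le> K" if "x \<in> {p..q}" for x
    using assms(2)[OF that] by (intro onorm_le) (simp, metis abs_ge_zero mult.commute mult_left_mono)
  then show ?thesis
    using differentiable_bound[of "{p..q}" f "\<lambda>x h. h *\<^sub>R f' x" K y z] assms
    by (simp add: has_vector_derivative_def)
qed

lemma sigma1_axis2: "sigma1 *v axis 2 1 = axis 1 1"
  by (simp add: vec_eq_iff forall_2 sigma1_def matrix_vector_mult_def sum_2 axis_def)

lemma sigma2_mult: "sigma2 *v v = v $ 1 *\<^sub>C axis 1 1"
  by (simp add: vec_eq_iff forall_2 sigma2_def matrix_vector_mult_def sum_2 axis_def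
      scaleC_vec_def scaleC_complex_def)

context sl_vessel
begin

definition b1 :: "real \<Rightarrow> 'h"
  where "b1 y = B y (axis 1 1)"

lemma adj_B:
  assumes "x \<in> I"
  shows "adj (B x) h = (\<chi> i. cinner (B x (axis i 1)) h)"
proof -
  let ?g = "\<chi> i. cinner (B x (axis i 1)) h"
  have lin: "B x (u + v) = B x u + B x v" "B x (k *\<^sub>C u) = k *\<^sub>C B x u" for u v k
    using B_bounded[OF assms] linear_add bounded_linear.linear by (auto simp: bounded_clinear_def)
  have adj: "cinner (B x f) h = cinner f ?g" for f
  proof -
    have f: "f = f $ 1 *\<^sub>C axis 1 1 + f $ 2 *\<^sub>C axis 2 1"
      by (simp add: vec_eq_iff forall_2 axis_def scaleC_vec_def scaleC_complex_def)
    have "B x f = B x (f $ 1 *\<^sub>C axis 1 1 + f $ 2 *\<^sub>C axis 2 1)"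
      by (rule arg_cong[OF f])
    also have "\<dots> = f $ 1 *\<^sub>C B x (axis 1 1) + f $ 2 *\<^sub>C B x (axis 2 1)"
      by (simp only: lin)
    finally show ?thesis
      by (simp add: cinner_add_left cinner_scaleC_left cinner_vec_def sum_2 cinner_complex_def)
  qed
  show ?thesis
    unfolding adj_on_def
  proof (rule the_equality)
    show "\<forall>f\<in>UNIV. cinner (B x f) h = cinner f ?g" by (intro ballI adj)
  next
    fix g assume "\<forall>f\<in>UNIV. cinner (B x f) h = cinner f g"
    then have g: "cinner f g = cinner f ?g" for f by (metis UNIV_I adj)
    have "cinner (g - ?g) (g - ?g) = 0"
      unfolding cinner_diff_right g by (rule diff_self)
    then show "g = ?g" by (simp add: cinner_self)
  qed
qed

lemma X_has_derivative:
  assumes "x \<in> I"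
  shows "((\<lambda>y. X y h) has_vector_derivative cinner (b1 x) h *\<^sub>C b1 x) (at x within I)"
proof -
  have "B x (sigma2 *v adj (B x) h) = cinner (b1 x) h *\<^sub>C b1 x"
    using B_bounded[OF assms] by (simp add: sigma2_mult adj_B[OF assms] b1_def bounded_clinear_def)
  then show ?thesis using X_deriv[OF assms, of h] by simp
qed

lemma continuous_b1: "continuous_on I b1"
proof -
  have "continuous (at x within I) b1" if "x \<in> I" for x
    using has_vector_derivative_continuous[OF B_deriv[OF that, of "axis 2 1"]]
    by (simp add: sigma1_axis2 b1_def[abs_def])
  then show ?thesis by (simp add: continuous_on_eq_continuous_within)
qed

text \<open>The entry in the second row and first column of the linkage condition: there \<open>\<gamma>\<close> and the
  term starting with \<open>\<sigma>\<^sub>2\<close> vanish.\<close>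

lemma beta_eq:
  assumes "x \<in> I"
  shows "cinner (b1 x) (inv (X x) (b1 x)) = - of_real (\<beta> x)"
proof -
  have "(gamma_star I \<beta> x *v axis 1 1) $ 2 = (gamma *v axis 1 1
      + sigma2 *v adj (B x) (inv (X x) (B x (sigma1 *v axis 1 1)))
      - sigma1 *v adj (B x) (inv (X x) (B x (sigma2 *v axis 1 1)))) $ 2"
    by (rule arg_cong[OF linkage[OF assms]])
  moreover have "(gamma_star I \<beta> x *v axis 1 1) $ 2 = of_real (\<beta> x)"
    and "(gamma *v axis 1 1) $ 2 = 0"
    by (simp_all add: gamma_star_def gamma_def matrix_vector_mult_def sum_2 axis_def)
  moreover have "(sigma1 *v v) $ 2 = v $ 1" "(sigma2 *v v) $ 2 = 0" for v
    by (simp_all add: sigma1_def sigma2_def matrix_vector_mult_def sum_2)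
  moreover have "sigma2 *v axis 1 1 = axis 1 1"
    by (simp add: sigma2_mult axis_def)
  ultimately have "of_real (\<beta> x) = - cinner (b1 x) (inv (X x) (b1 x))"
    by (simp add: adj_B[OF assms] b1_def)
  then show ?thesis by simp
qed

lemma X_inv:
  assumes "x \<in> I"
  shows "X x (inv (X x) h) = h" "inv (X x) (X x h) = h"
  using X_invertible[OF assms] by (auto simp: bij_def surj_f_inv_f)

lemma inv_X_selfadjoint:
  assumes "x \<in> I"
  shows "cinner (inv (X x) u) v = cinner u (inv (X x) v)"
  using X_selfadjoint[OF assms, of "inv (X x) u" "inv (X x) v"] X_inv[OF assms] by simp

lemma bounded_linear_X: "x \<in> I \<Longrightarrow> bounded_linear (X x)"
  and bounded_linear_inv_X: "x \<in> I \<Longrightarrow> bounded_linear (inv (X x))"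
  using X_bounded X_invertible by (auto simp: bounded_clinear_def)

lemma inv_X_scaleC: "x \<in> I \<Longrightarrow> inv (X x) (k *\<^sub>C h) = k *\<^sub>C inv (X x) h"
  using X_invertible by (auto simp: bounded_clinear_def)

end

text \<open>On a compact segment the norms of \<open>b\<close>, \<open>X\<close> and \<open>X\<^sup>-\<^sup>1\<close> have uniform bounds, which the
  vessel does not provide on all of \<open>I\<close>.\<close>

locale vessel_segment = sl_vessel DA A B X \<beta> I
  for DA :: "'h::complex_hilbert_space set" and A B X \<beta> I +
  fixes p q x0 :: real
  assumes segment: "{p..q} \<subseteq> I" and x0: "x0 \<in> {p..q}"
begin

text \<open>\<open>N\<close> is the operator whose Fredholm determinant is the tau function, and \<open>c\<close> is the range
  vector of its rank one derivative.\<close>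

definition c1 :: "real \<Rightarrow> 'h"
  where "c1 y = inv (X x0) (b1 y)"

definition N :: "real \<Rightarrow> 'h \<Rightarrow> 'h"
  where "N y h = inv (X x0) (X y h)"

lemma x0_I: "x0 \<in> I" using segment x0 by blast

lemma segment_I: "y \<in> {p..q} \<Longrightarrow> y \<in> I" using segment by blast

lemma X_deriv_segment:
  assumes "y \<in> {p..q}"
  shows "((\<lambda>y. X y h) has_vector_derivative cinner (b1 y) h *\<^sub>C b1 y) (at y within {p..q})"
  using X_has_derivative[OF segment_I[OF assms]] segment by (rule has_vector_derivative_within_subset)

lemma N_deriv:
  assumes "y \<in> {p..q}"
  shows "((\<lambda>y. N y h) has_vector_derivative cinner (b1 y) h *\<^sub>C c1 y) (at y within {p..q})"
  using bounded_linear.has_vector_derivative[OF bounded_linear_inv_X[OF x0_I] X_deriv_segment[OF assms, of h]]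
  by (simp add: N_def[abs_def] c1_def inv_X_scaleC[OF x0_I])

lemma N_x0: "N x0 h = h"
  by (simp add: N_def X_inv[OF x0_I])

lemma bounded_linear_N: "y \<in> {p..q} \<Longrightarrow> bounded_linear (N y)"
  unfolding N_def[abs_def]
  using bounded_linear_compose[OF bounded_linear_inv_X[OF x0_I] bounded_linear_X] segment_I by blast

lemma N_scaleC: "y \<in> {p..q} \<Longrightarrow> N y (k *\<^sub>C h) = k *\<^sub>C N y h"
  using X_bounded[OF segment_I] by (simp add: N_def inv_X_scaleC[OF x0_I] bounded_clinear_def)

lemma continuous_b1_segment: "continuous_on {p..q} b1"
  using continuous_b1 segment by (rule continuous_on_subset)

lemma continuous_c1: "continuous_on {p..q} c1"
  unfolding c1_def[abs_def]
  by (intro bounded_linear.continuous_on[OF bounded_linear_inv_X[OF x0_I]] continuous_b1_segment)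

lemma bounded_on_segment:
  fixes f :: "real \<Rightarrow> 'h"
  assumes "continuous_on {p..q} f"
  shows "\<exists>M>0. \<forall>y\<in>{p..q}. norm (f y) \<le> M"
  using compact_imp_bounded[OF compact_continuous_image[OF assms compact_Icc]]
  unfolding bounded_pos by simp

lemma X_Lipschitz:
  "\<exists>K>0. \<forall>y\<in>{p..q}. \<forall>z\<in>{p..q}. \<forall>h. norm (X y h - X z h) \<le> K * norm h * \<bar>y - z\<bar>"
proof -
  obtain M where M: "M > 0" "\<And>y. y \<in> {p..q} \<Longrightarrow> norm (b1 y) \<le> M"
    using bounded_on_segment[OF continuous_b1_segment] by metis
  have "norm (X y h - X z h) \<le> M * M * norm h * \<bar>y - z\<bar>" if "y \<in> {p..q}" "z \<in> {p..q}" for y z h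
  proof (rule norm_diff_le_derivative_bound[OF X_deriv_segment _ that])
    fix x assume x: "x \<in> {p..q}"
    have "norm (cinner (b1 x) h *\<^sub>C b1 x) \<le> norm (b1 x) * norm h * norm (b1 x)"
      unfolding norm_scaleC by (intro mult_right_mono norm_cinner_le) simp
    also have "\<dots> \<le> M * norm h * M"
      using M x by (intro mult_mono) auto
    finally show "norm (cinner (b1 x) h *\<^sub>C b1 x) \<le> M * M * norm h" by (simp add: mult_ac)
  qed
  then show ?thesis using M(1) by (intro exI[of _ "M * M"]) simp
qed

text \<open>Otherwise \<open>\<parallel>X(y\<^sub>n)h\<^sub>n\<parallel> < \<parallel>h\<^sub>n\<parallel>/(n+1)\<close> for some sequences, and \<open>y\<^sub>n\<close> accumulates at a
  point \<open>l\<close>; by the Lipschitz bound \<open>\<parallel>X(l)h\<^sub>n\<parallel>/\<parallel>h\<^sub>n\<parallel>\<close> comes arbitrarily close to 0, although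
  \<open>X(l)\<close> has a bounded inverse.\<close>

lemma X_bounded_below:
  "\<exists>\<delta>>0. \<forall>y\<in>{p..q}. \<forall>h. \<delta> * norm h \<le> norm (X y h)"
proof -
  obtain K where K: "K > 0"
    "\<And>y z h. y \<in> {p..q} \<Longrightarrow> z \<in> {p..q} \<Longrightarrow> norm (X y h - X z h) \<le> K * norm h * \<bar>y - z\<bar>"
    using X_Lipschitz by metis
  show ?thesis
  proof (rule ccontr)
    assume "\<not> ?thesis"
    then have "\<forall>n. \<exists>y h. y \<in> {p..q} \<and> norm (X y h) < 1 / real (Suc n) * norm h"
      by (metis not_le of_nat_0_less_iff zero_less_Suc zero_less_divide_1_iff)
    then obtain y h where y: "\<And>n. y n \<in> {p..q}"
      and h: "\<And>n. norm (X (y n) (h n)) < 1 / real (Suc n) * norm (h n)" by metis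
    obtain l r where l: "l \<in> {p..q}" and r: "strict_mono r" and lim: "(y \<circ> r) \<longlonglongrightarrow> l"
      using compact_Icc[of p q] y unfolding compact_def by metis
    obtain L where L: "L > 0" "\<And>h. norm (inv (X l) h) \<le> norm h * L"
      using bounded_linear.pos_bounded[OF bounded_linear_inv_X[OF segment_I[OF l]]] by blast
    have "1 / L \<le> 1 / real (Suc (r n)) + K * \<bar>y (r n) - l\<bar>" for n
    proof -
      have "norm (h (r n)) \<le> norm (X l (h (r n))) * L"
        using L(2)[of "X l (h (r n))"] X_inv[OF segment_I[OF l]] by simp
      then have "norm (h (r n)) / L \<le> norm (X l (h (r n)))"
        using L(1) by (simp add: field_simps)
      also have "\<dots> \<le> norm (X (y (r n)) (h (r n))) + norm (X l (h (r n)) - X (y (r n)) (h (r n)))"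
        using norm_triangle_ineq[of "X (y (r n)) (h (r n))" "X l (h (r n)) - X (y (r n)) (h (r n))"]
        by simp
      also have "\<dots> \<le> 1 / real (Suc (r n)) * norm (h (r n)) + K * norm (h (r n)) * \<bar>l - y (r n)\<bar>"
        by (rule add_mono[OF less_imp_le[OF h] K(2)[OF l y]])
      finally have "norm (h (r n)) * (1 / L) \<le> norm (h (r n)) * (1 / real (Suc (r n)) + K * \<bar>y (r n) - l\<bar>)"
        by (simp add: algebra_simps abs_minus_commute)
      moreover have "0 < norm (h (r n))"
      proof -
        have "0 < 1 / real (Suc (r n)) * norm (h (r n))"
          using h[of "r n"] norm_ge_zero[of "X (y (r n)) (h (r n))"] by linarith
        then show ?thesis by auto
      qed
      ultimately show ?thesis by (rule mult_left_le_imp_le)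
    qed
    moreover have "(\<lambda>n. 1 / real (Suc (r n)) + K * \<bar>y (r n) - l\<bar>) \<longlonglongrightarrow> 0 + K * \<bar>l - l\<bar>"
    proof (intro tendsto_intros)
      show "(\<lambda>n. 1 / real (Suc (r n))) \<longlonglongrightarrow> 0"
        using LIMSEQ_subseq_LIMSEQ[OF LIMSEQ_inverse_real_of_nat r] by (simp add: o_def inverse_eq_divide)
      show "(\<lambda>n. y (r n)) \<longlonglongrightarrow> l" using lim by (simp add: o_def)
    qed
    ultimately have "1 / L \<le> 0"
      by (intro LIMSEQ_le_const[where X = "\<lambda>n. 1 / real (Suc (r n)) + K * \<bar>y (r n) - l\<bar>"]) auto
    then show False using L(1) by simp
  qed
qed

end

context vessel_segment
begin

section \<open>The finite determinants and their logarithmic derivative\<close>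

text \<open>By Jacobi and Cramer, the derivative of the finite determinant \<open>D\<close> is \<open>\<langle>b,z\<rangle>\<close> where
  \<open>z\<close> solves the compressed equation \<open>P N z = D P c\<close> and \<open>P\<close> is the projection onto the span of
  \<open>S\<close>.\<close>

lemma finite_det_derivative:
  assumes S: "finite S" "orthonormal S" and y: "y \<in> {p..q}"
  shows "\<exists>z. ((\<lambda>y. principal_minor (N y) S) has_vector_derivative cinner (b1 y) z) (at y within {p..q})
    \<and> proj S z = z \<and> proj S (N y z) = principal_minor (N y) S *\<^sub>C proj S (c1 y)"
proof -
  define m where "m y e f = cinner e (N y f)" for y e f
  define \<zeta> where "\<zeta> f = gdet S (replace_col (m y) f (\<lambda>e. cinner e (c1 y)))" for f
  define z where "z = (\<Sum>f\<in>S. \<zeta> f *\<^sub>C f)"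
  have entry: "((\<lambda>y. m y e f) has_vector_derivative cinner e (c1 y) * cinner (b1 y) f) (at y within {p..q})"
    for e f
    using bounded_linear.has_vector_derivative[OF
        bounded_bilinear.bounded_linear_right[OF bounded_bilinear_cinner] N_deriv[OF y, of f], of e]
    by (simp add: m_def cinner_scaleC_right mult.commute)
  have "((\<lambda>y. gdet S (m y)) has_vector_derivative (\<Sum>f\<in>S. cinner (b1 y) f * \<zeta> f)) (at y within {p..q})"
    unfolding \<zeta>_def by (rule gdet_has_vector_derivative[OF S(1) entry])
  moreover have "(\<Sum>f\<in>S. cinner (b1 y) f * \<zeta> f) = cinner (b1 y) z"
    by (simp add: z_def cinner_sum_right cinner_scaleC_right mult.commute)
  moreover have "proj S z = z"
  proof -
    have "cinner e z = \<zeta> e" if "e \<in> S" for e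
    proof -
      have "cinner e z = (\<Sum>f\<in>S. if f = e then \<zeta> e else 0)"
        unfolding z_def cinner_sum_right cinner_scaleC_right
        using S(2) that by (intro sum.cong) (auto simp: orthonormal_def)
      then show ?thesis using S(1) that by simp
    qed
    then show ?thesis by (simp add: proj_def z_def)
  qed
  moreover have "proj S (N y z) = gdet S (m y) *\<^sub>C proj S (c1 y)"
  proof -
    have Nz: "N y z = (\<Sum>f\<in>S. \<zeta> f *\<^sub>C N y f)"
      unfolding z_def using bounded_linear_N[OF y]
      by (simp add: linear_sum bounded_linear.linear N_scaleC[OF y])
    have "cinner e (N y z) = gdet S (m y) * cinner e (c1 y)" if "e \<in> S" for e
    proof -
      have "cinner e (N y z) = (\<Sum>f\<in>S. m y e f * \<zeta> f)"
        unfolding Nz by (simp add: cinner_sum_right cinner_scaleC_right m_def mult.commute)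
      also have "\<dots> = gdet S (m y) * cinner e (c1 y)"
        unfolding \<zeta>_def by (rule gdet_Cramer[OF S(1) that])
      finally show ?thesis .
    qed
    then show ?thesis
      unfolding proj_def
      by (simp add: bounded_bilinear.sum_right[OF bounded_bilinear_scaleC] scaleC_scaleC)
  qed
  ultimately show ?thesis
    unfolding principal_minor_gdet m_def by (intro exI[of _ z]) simp
qed

text \<open>Let \<open>P\<close> be the projection. As \<open>N(x\<^sub>0) = 1\<close> and \<open>P z = z\<close>, the defect vanishes at
  \<open>x\<^sub>0\<close>, and its derivative \<open>\<langle>b,z\<rangle>(1 - P)c\<close> is controlled by the error in approximating \<open>c\<close>.\<close>

lemma proj_defect:
  assumes S: "finite S" "orthonormal S" and y: "y \<in> {p..q}"
    and \<epsilon>: "\<And>y. y \<in> {p..q} \<Longrightarrow> norm (c1 y - proj S (c1 y)) \<le> \<epsilon>"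
    and M: "\<And>y. y \<in> {p..q} \<Longrightarrow> norm (b1 y) \<le> M"
    and z: "proj S z = z"
  shows "norm (N y z - proj S (N y z)) \<le> \<epsilon> * M * (q - p) * norm z"
proof -
  have M0: "0 \<le> M" using M[OF y] norm_ge_zero[of "b1 y"] by linarith
  have e0: "0 \<le> \<epsilon>" using \<epsilon>[OF y] norm_ge_zero[of "c1 y - proj S (c1 y)"] by linarith
  have lin: "bounded_linear (\<lambda>h. h - proj S h)"
    unfolding proj_def
    by (intro bounded_linear_sub bounded_linear_ident bounded_linear_sum
        bounded_linear_compose[OF bounded_bilinear.bounded_linear_left[OF bounded_bilinear_scaleC]
          bounded_bilinear.bounded_linear_right[OF bounded_bilinear_cinner]])
  have scale: "k *\<^sub>C h - proj S (k *\<^sub>C h) = k *\<^sub>C (h - proj S h)" for k h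
    by (simp add: proj_def cinner_scaleC_right bounded_bilinear.sum_right[OF bounded_bilinear_scaleC]
        bounded_bilinear.diff_right[OF bounded_bilinear_scaleC] scaleC_scaleC)
  have "norm ((N y z - proj S (N y z)) - (N x0 z - proj S (N x0 z)))
      \<le> (M * norm z * \<epsilon>) * \<bar>y - x0\<bar>"
  proof (rule norm_diff_le_derivative_bound[OF _ _ y x0])
    fix x assume x: "x \<in> {p..q}"
    show "((\<lambda>y. N y z - proj S (N y z)) has_vector_derivative
        cinner (b1 x) z *\<^sub>C (c1 x - proj S (c1 x))) (at x within {p..q})"
      using bounded_linear.has_vector_derivative[OF lin N_deriv[OF x, of z]] by (simp add: scale)
    have "norm (cinner (b1 x) z) \<le> norm (b1 x) * norm z" by (rule norm_cinner_le)
    also have "\<dots> \<le> M * norm z" using M[OF x] by (rule mult_right_mono) simp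
    finally show "norm (cinner (b1 x) z *\<^sub>C (c1 x - proj S (c1 x))) \<le> M * norm z * \<epsilon>"
      unfolding norm_scaleC using \<epsilon>[OF x] M0 by (intro mult_mono) auto
  qed
  also have "\<dots> \<le> (M * norm z * \<epsilon>) * (q - p)"
    using y x0 M0 e0 by (intro mult_left_mono) auto
  finally show ?thesis by (simp add: N_x0 z mult_ac)
qed

text \<open>With \<open>a = X(x\<^sub>0)X\<^sup>-\<^sup>1b\<close> one has \<open>\<langle>b,z\<rangle> = \<langle>a,Nz\<rangle>\<close>, so the compressed equation
  gives \<open>D' \<approx> D\<langle>a,c\<rangle> = D\<langle>b,X\<^sup>-\<^sup>1b\<rangle> = -\<beta>D\<close>. The error is relative to \<open>D\<close> because
  \<open>N\<close> is bounded below: this bounds \<open>z\<close> by a multiple of \<open>D\<close>.\<close>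

lemma finite_det_log_derivative:
  "\<exists>C>0. \<exists>e0>0. \<forall>\<epsilon> S. 0 \<le> \<epsilon> \<longrightarrow> \<epsilon> \<le> e0 \<longrightarrow> finite S \<longrightarrow> orthonormal S \<longrightarrow>
    (\<forall>y\<in>{p..q}. norm (c1 y - proj S (c1 y)) \<le> \<epsilon>) \<longrightarrow>
    (\<forall>y\<in>{p..q}. \<exists>d. ((\<lambda>y. principal_minor (N y) S) has_vector_derivative d) (at y within {p..q})
      \<and> norm (d + of_real (\<beta> y) * principal_minor (N y) S) \<le> C * \<epsilon> * norm (principal_minor (N y) S))"
proof -
  obtain M where M: "M > 0" "\<And>y. y \<in> {p..q} \<Longrightarrow> norm (b1 y) \<le> M"
    using bounded_on_segment[OF continuous_b1_segment] by metis
  obtain Mc where Mc: "Mc > 0" "\<And>y. y \<in> {p..q} \<Longrightarrow> norm (c1 y) \<le> Mc"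
    using bounded_on_segment[OF continuous_c1] by metis
  obtain \<delta> where \<delta>: "\<delta> > 0" "\<And>y h. y \<in> {p..q} \<Longrightarrow> \<delta> * norm h \<le> norm (X y h)"
    using X_bounded_below by metis
  obtain K where K: "K > 0" "\<And>h. norm (X x0 h) \<le> norm h * K"
    using bounded_linear.pos_bounded[OF bounded_linear_X[OF x0_I]] by blast
  define \<eta> where "\<eta> = \<delta> / K"
  have \<eta>: "\<eta> > 0" using \<delta> K by (simp add: \<eta>_def)
  have N_below: "\<eta> * norm h \<le> norm (N y h)" if "y \<in> {p..q}" for y h
  proof -
    have "\<delta> * norm h \<le> norm (X x0 (N y h))"
      using \<delta>(2)[OF that] by (simp add: N_def X_inv[OF x0_I])
    also have "\<dots> \<le> norm (N y h) * K" by (rule K)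
    finally show ?thesis using K(1) by (simp add: \<eta>_def field_simps)
  qed
  define L where "L = q - p"
  have L: "0 \<le> L" using x0 by (simp add: L_def)
  define a where "a y = X x0 (inv (X y) (b1 y))" for y
  define Ma where "Ma = M / \<delta> * K"
  have Ma0: "Ma > 0" using M \<delta> K by (simp add: Ma_def)
  have Ma: "norm (a y) \<le> Ma" if y: "y \<in> {p..q}" for y
  proof -
    have "\<delta> * norm (inv (X y) (b1 y)) \<le> M"
      using \<delta>(2)[OF y, of "inv (X y) (b1 y)"] M(2)[OF y] by (simp add: X_inv[OF segment_I[OF y]])
    then have "norm (inv (X y) (b1 y)) \<le> M / \<delta>" using \<delta>(1) by (simp add: field_simps)
    then have "norm (inv (X y) (b1 y)) * K \<le> M / \<delta> * K" using K(1) by (intro mult_right_mono) auto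
    then show ?thesis unfolding a_def Ma_def using K(2) order_trans by blast
  qed
  define C where "C = Ma * (M * L * (2 / \<eta> * Mc)) + Ma"
  \<comment> \<open>For \<open>\<epsilon> \<le> e0\<close> the defect of \<open>N z\<close> is at most \<open>\<eta>/2 \<parallel>z\<parallel>\<close>, half of the lower bound on \<open>N z\<close>.\<close>
  define e0 where "e0 = \<eta> / (2 * (M * L + 1))"
  have nonneg_ML: "0 \<le> M * L" using M L by simp
  have C0: "0 < C" unfolding C_def
    using Ma0 \<eta> Mc(1) M(1) L by (intro add_nonneg_pos mult_nonneg_nonneg) auto
  have e0: "0 < e0" using \<eta> nonneg_ML by (simp add: e0_def)
  have main: "\<exists>d. ((\<lambda>y. principal_minor (N y) S) has_vector_derivative d) (at y within {p..q})
      \<and> norm (d + of_real (\<beta> y) * principal_minor (N y) S) \<le> C * \<epsilon> * norm (principal_minor (N y) S)"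
    if \<epsilon>: "0 \<le> \<epsilon>" "\<epsilon> \<le> e0" and S: "finite S" "orthonormal S"
      and close: "\<forall>y\<in>{p..q}. norm (c1 y - proj S (c1 y)) \<le> \<epsilon>" and y: "y \<in> {p..q}" for \<epsilon> S y
  proof -
    define D where "D = principal_minor (N y) S"
    obtain z where z: "((\<lambda>y. principal_minor (N y) S) has_vector_derivative cinner (b1 y) z) (at y within {p..q})"
      and pz: "proj S z = z" and pN: "proj S (N y z) = D *\<^sub>C proj S (c1 y)"
      using finite_det_derivative[OF S y] unfolding D_def[symmetric] by (elim exE conjE) (rule that)
    have closey: "norm (c1 y - proj S (c1 y)) \<le> \<epsilon>" using close y by blast
    have defect: "norm (N y z - D *\<^sub>C proj S (c1 y)) \<le> \<epsilon> * M * L * norm z"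
      using proj_defect[OF S y _ M(2) pz, of \<epsilon>] close by (simp add: pN L_def)
    have "\<epsilon> * (M * L) \<le> e0 * (M * L + 1)" using \<epsilon> nonneg_ML by (intro mult_mono) auto
    also have "\<dots> = \<eta> / 2" using nonneg_ML by (simp add: e0_def field_simps)
    finally have small: "\<epsilon> * M * L \<le> \<eta> / 2" by (simp add: mult.assoc)
    have "\<eta> * norm z \<le> norm (N y z)" by (rule N_below[OF y])
    also have "\<dots> \<le> norm (D *\<^sub>C proj S (c1 y)) + norm (N y z - D *\<^sub>C proj S (c1 y))"
      using norm_triangle_ineq[of "D *\<^sub>C proj S (c1 y)" "N y z - D *\<^sub>C proj S (c1 y)"] by simp
    also have "norm (D *\<^sub>C proj S (c1 y)) \<le> norm D * Mc"
      unfolding norm_scaleC using norm_proj_le[OF S(2,1), of "c1 y"] Mc(2)[OF y]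
      by (intro mult_left_mono) auto
    also have "norm (N y z - D *\<^sub>C proj S (c1 y)) \<le> \<eta> / 2 * norm z"
      using defect mult_right_mono[OF small norm_ge_zero[of z]] by linarith
    finally have zD: "norm z \<le> 2 / \<eta> * Mc * norm D" using \<eta> by (simp add: field_simps)
    have az: "cinner (b1 y) z = cinner (a y) (N y z)"
      by (simp add: a_def N_def X_selfadjoint[OF x0_I] X_inv[OF x0_I] inv_X_selfadjoint[OF segment_I[OF y]]
          X_inv[OF segment_I[OF y]])
    have ac: "cinner (a y) (c1 y) = - of_real (\<beta> y)"
      by (simp add: a_def c1_def X_selfadjoint[OF x0_I] X_inv[OF x0_I] inv_X_selfadjoint[OF segment_I[OF y]]
          beta_eq[OF segment_I[OF y]])
    have "cinner (b1 y) z + of_real (\<beta> y) * D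
        = cinner (a y) (N y z - D *\<^sub>C proj S (c1 y)) - D * cinner (a y) (c1 y - proj S (c1 y))"
      by (simp add: az cinner_diff_right cinner_scaleC_right ac algebra_simps)
    then have "norm (cinner (b1 y) z + of_real (\<beta> y) * D)
        \<le> norm (cinner (a y) (N y z - D *\<^sub>C proj S (c1 y))) + norm (D * cinner (a y) (c1 y - proj S (c1 y)))"
      by (metis norm_triangle_ineq4)
    also have "norm (cinner (a y) (N y z - D *\<^sub>C proj S (c1 y))) \<le> Ma * (\<epsilon> * M * L * (2 / \<eta> * Mc * norm D))"
    proof (rule order_trans[OF norm_cinner_le], rule mult_mono[OF Ma[OF y]])
      have "\<epsilon> * M * L * norm z \<le> \<epsilon> * M * L * (2 / \<eta> * Mc * norm D)"
        using zD \<epsilon> M(1) L by (intro mult_left_mono) auto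
      then show "norm (N y z - D *\<^sub>C proj S (c1 y)) \<le> \<epsilon> * M * L * (2 / \<eta> * Mc * norm D)"
        using defect by linarith
    qed (use Ma0 in auto)
    also have "norm (D * cinner (a y) (c1 y - proj S (c1 y))) \<le> norm D * (Ma * \<epsilon>)"
      unfolding norm_mult using Ma[OF y] closey Ma0
      by (intro mult_left_mono order_trans[OF norm_cinner_le] mult_mono) auto
    finally have "norm (cinner (b1 y) z + of_real (\<beta> y) * D) \<le> C * \<epsilon> * norm D"
      by (simp add: C_def algebra_simps)
    then show ?thesis using z unfolding D_def by blast
  qed
  show ?thesis
    by (intro exI[of _ C] exI[of _ e0] conjI C0 e0 allI impI ballI) (rule main; assumption)
qed

text \<open>If \<open>m\<close> is the maximum of \<open>\<bar>u\<bar>\<close>, the mean value inequality gives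
  \<open>m \<le> 1 + \<epsilon> m (q - p) \<le> 1 + m/2\<close>, hence \<open>m \<le> 2\<close>; inserting this bound in the same
  inequality gives the claim.\<close>

lemma near_one_of_relative_derivative_bound:
  fixes u :: "real \<Rightarrow> complex"
  assumes u: "\<And>y. y \<in> {p..q} \<Longrightarrow> (u has_vector_derivative u' y) (at y within {p..q})"
    and u': "\<And>y. y \<in> {p..q} \<Longrightarrow> norm (u' y) \<le> \<epsilon> * norm (u y)"
    and "u x0 = 1" and \<epsilon>: "0 \<le> \<epsilon>" "\<epsilon> * (q - p) \<le> 1/2" and x: "x \<in> {p..q}"
  shows "norm (u x - 1) \<le> 2 * \<epsilon> * (q - p)"
proof -
  have "continuous_on {p..q} u"
    unfolding continuous_on_eq_continuous_within
  proof
    show "continuous (at y within {p..q}) u" if "y \<in> {p..q}" for y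
      by (rule has_vector_derivative_continuous[OF u[OF that]])
  qed
  then have "continuous_on {p..q} (\<lambda>y. norm (u y))" by (rule continuous_on_norm)
  then have "\<exists>m\<in>{p..q}. \<forall>y\<in>{p..q}. norm (u y) \<le> norm (u m)"
    using x by (intro continuous_attains_sup[OF compact_Icc]) auto
  then obtain m where m: "m \<in> {p..q}" "\<And>y. y \<in> {p..q} \<Longrightarrow> norm (u y) \<le> norm (u m)"
    by metis
  have dev: "norm (u y - 1) \<le> \<epsilon> * norm (u m) * (q - p)" if y: "y \<in> {p..q}" for y
  proof -
    have "norm (u y - u x0) \<le> \<epsilon> * norm (u m) * \<bar>y - x0\<bar>"
    proof (rule norm_diff_le_derivative_bound[OF u _ y x0])
      fix x assume x: "x \<in> {p..q}"
      show "norm (u' x) \<le> \<epsilon> * norm (u m)"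
        using u'[OF x] mult_left_mono[OF m(2)[OF x] \<epsilon>(1)] by linarith
    qed
    also have "\<dots> \<le> \<epsilon> * norm (u m) * (q - p)" using y x0 \<epsilon> by (intro mult_left_mono) auto
    finally show ?thesis using assms(3) by simp
  qed
  have "norm (u m) \<le> 1 + norm (u m - 1)" using norm_triangle_ineq[of 1 "u m - 1"] by simp
  also have "\<dots> \<le> 1 + (\<epsilon> * (q - p)) * norm (u m)" using dev[OF m(1)] by (simp add: mult_ac)
  also have "\<dots> \<le> 1 + 1/2 * norm (u m)" using \<epsilon> by (intro add_left_mono mult_right_mono) auto
  finally have "norm (u m) \<le> 2" by simp
  then have "(\<epsilon> * (q - p)) * norm (u m) \<le> (\<epsilon> * (q - p)) * 2"
    using \<epsilon> x by (intro mult_left_mono) auto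
  then show ?thesis using dev[OF x] by (simp add: mult_ac)
qed

text \<open>The quotient of the finite determinant by \<open>exp G\<close> has a small relative derivative and the
  value 1 at \<open>x\<^sub>0\<close>.\<close>

lemma finite_det_limit:
  assumes E: "orthonormal_basis E"
    and G: "\<And>y. y \<in> {p..q} \<Longrightarrow> (G has_vector_derivative - \<beta> y) (at y within {p..q})"
    and G0: "G x0 = 0" and x: "x \<in> {p..q}"
  shows "((\<lambda>S. principal_minor (N x) S) \<longlongrightarrow> of_real (exp (G x))) (finite_subsets_at_top E)"
proof -
  have "orthonormal E" using E unfolding orthonormal_basis_def orthonormal_def by (rule conjunct1)
  then have on: "orthonormal S" if "S \<subseteq> E" for S using that by (rule orthonormal_subset)
  obtain C e0 where C: "C > 0" and e0: "e0 > 0"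
    and logd: "\<forall>\<epsilon> S. 0 \<le> \<epsilon> \<longrightarrow> \<epsilon> \<le> e0 \<longrightarrow> finite S \<longrightarrow> orthonormal S \<longrightarrow>
      (\<forall>y\<in>{p..q}. norm (c1 y - proj S (c1 y)) \<le> \<epsilon>) \<longrightarrow>
      (\<forall>y\<in>{p..q}. \<exists>d. ((\<lambda>y. principal_minor (N y) S) has_vector_derivative d) (at y within {p..q})
        \<and> norm (d + of_real (\<beta> y) * principal_minor (N y) S) \<le> C * \<epsilon> * norm (principal_minor (N y) S))"
    using finite_det_log_derivative by (elim exE conjE) (rule that)
  define L where "L = q - p"
  have L: "0 \<le> L" using x0 by (simp add: L_def)
  define u where "u S y = principal_minor (N y) S * of_real (exp (- G y))" for S y
  have "((\<lambda>S. u S x) \<longlongrightarrow> 1) (finite_subsets_at_top E)"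
  proof (rule tendstoI)
    fix r :: real assume r: "r > 0"
    \<comment> \<open>Small enough for the relative derivative bound \<open>C \<epsilon>\<close> to satisfy \<open>2 C \<epsilon> L < min 1 r\<close>.\<close>
    define \<epsilon> where "\<epsilon> = min e0 (min 1 r / (4 * C * (L + 1)))"
    have \<epsilon>: "0 < \<epsilon>" "\<epsilon> \<le> e0" using r C L e0 by (auto simp: \<epsilon>_def)
    have "0 < 4 * C * (L + 1)" using C L by simp
    moreover have "\<epsilon> \<le> min 1 r / (4 * C * (L + 1))" unfolding \<epsilon>_def by (rule min.cobounded2)
    ultimately have "\<epsilon> * (4 * C * (L + 1)) \<le> min 1 r" by (simp only: pos_le_divide_eq)
    then have \<epsilon>r: "4 * (C * \<epsilon>) * (L + 1) \<le> min 1 r" by (simp add: mult_ac)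
    have "4 * (C * \<epsilon> * L) < 4 * (C * \<epsilon>) * (L + 1)" using C \<epsilon> by (simp add: algebra_simps)
    then have "4 * (C * \<epsilon> * L) < 1" "4 * (C * \<epsilon> * L) < r"
      using \<epsilon>r min.cobounded1[of 1 r] min.cobounded2[of 1 r] by linarith+
    moreover have "0 \<le> C * \<epsilon> * L" using C \<epsilon> L by simp
    ultimately have \<epsilon>L: "C * \<epsilon> * L \<le> 1/2" "2 * (C * \<epsilon> * L) < r" by linarith+
    have "\<forall>\<^sub>F S in finite_subsets_at_top E. finite S \<and> S \<subseteq> E"
      by (rule eventually_finite_subsets_at_top_weakI) simp
    with proj_approximates_compact[OF E compact_Icc continuous_c1 \<epsilon>(1)]
    show "\<forall>\<^sub>F S in finite_subsets_at_top E. dist (u S x) 1 < r"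
    proof eventually_elim
      case (elim S)
      then have S: "finite S" "orthonormal S" and close: "\<forall>y\<in>{p..q}. norm (c1 y - proj S (c1 y)) \<le> \<epsilon>"
        using on by auto
      have "\<forall>y\<in>{p..q}. \<exists>d. ((\<lambda>y. principal_minor (N y) S) has_vector_derivative d) (at y within {p..q})
          \<and> norm (d + of_real (\<beta> y) * principal_minor (N y) S) \<le> C * \<epsilon> * norm (principal_minor (N y) S)"
        using logd less_imp_le[OF \<epsilon>(1)] \<epsilon>(2) S close by simp
      then obtain d where "\<forall>y\<in>{p..q}.
          ((\<lambda>y. principal_minor (N y) S) has_vector_derivative d y) (at y within {p..q})
          \<and> norm (d y + of_real (\<beta> y) * principal_minor (N y) S) \<le> C * \<epsilon> * norm (principal_minor (N y) S)"
        by (rule bchoice[THEN exE])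
      then have d: "\<And>y. y \<in> {p..q} \<Longrightarrow>
          ((\<lambda>y. principal_minor (N y) S) has_vector_derivative d y) (at y within {p..q})"
        and d_le: "\<And>y. y \<in> {p..q} \<Longrightarrow> norm (d y + of_real (\<beta> y) * principal_minor (N y) S)
          \<le> C * \<epsilon> * norm (principal_minor (N y) S)"
        by simp_all
      define u' where "u' y = (d y + of_real (\<beta> y) * principal_minor (N y) S) * of_real (exp (- G y))" for y
      have "norm (u S x - 1) \<le> 2 * (C * \<epsilon>) * (q - p)"
      proof (rule near_one_of_relative_derivative_bound[OF _ _ _ _ _ x])
        show "u S x0 = 1"
        proof -
          have "principal_minor (N x0) S = gdet S (\<lambda>e f. if e = f then 1 else 0)"
            unfolding principal_minor_gdet N_x0
            using S(2) by (intro gdet_cong) (auto simp: orthonormal_def)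
          then show ?thesis using gdet_identity[OF S(1)] G0 by (simp add: u_def)
        qed
        show "(u S has_vector_derivative u' y) (at y within {p..q})" if y: "y \<in> {p..q}" for y
        proof -
          have "((\<lambda>y. exp (- G y)) has_real_derivative exp (- G y) * \<beta> y) (at y within {p..q})"
            using G[OF y] unfolding has_real_derivative_iff_has_vector_derivative[symmetric]
            by (auto intro!: derivative_eq_intros)
          then have "((\<lambda>y. complex_of_real (exp (- G y))) has_vector_derivative of_real (exp (- G y) * \<beta> y))
              (at y within {p..q})"
            unfolding has_real_derivative_iff_has_vector_derivative
            by (rule bounded_linear.has_vector_derivative[OF bounded_linear_of_real])
          from has_vector_derivative_mult[OF d[OF y] this]
          show ?thesis by (simp add: u_def[abs_def] u'_def algebra_simps)
        qed
        show "norm (u' y) \<le> C * \<epsilon> * norm (u S y)" if y: "y \<in> {p..q}" for y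
          using mult_right_mono[OF d_le[OF y], of "exp (- G y)"]
          by (simp add: u'_def u_def norm_mult mult_ac)
      qed (use C \<epsilon> \<epsilon>L in \<open>auto simp: L_def\<close>)
      then show ?case using \<epsilon>L(2) by (simp add: dist_norm L_def mult.assoc)
    qed
  qed
  then have "((\<lambda>S. u S x * of_real (exp (G x))) \<longlongrightarrow> 1 * of_real (exp (G x))) (finite_subsets_at_top E)"
    by (intro tendsto_intros)
  moreover have "u S x * of_real (exp (G x)) = principal_minor (N x) S" for S
    unfolding u_def mult.assoc of_real_mult[symmetric] by (simp flip: exp_add)
  ultimately show ?thesis by simp
qed

end

context vessel_segment
begin

section \<open>Trace class bounds along a segment\<close>

lemma quadratic_form_deriv:
  assumes "y \<in> {p..q}"
  shows "((\<lambda>y. Re (cinner v (X y v))) has_vector_derivative (norm (cinner (b1 y) v))\<^sup>2) (at y within {p..q})"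
proof -
  have "bounded_linear (\<lambda>w. Re (cinner v w))"
    by (intro bounded_linear_compose[OF bounded_linear_Re]
        bounded_bilinear.bounded_linear_right[OF bounded_bilinear_cinner])
  moreover have "Re (cinner v (cinner (b1 y) v *\<^sub>C b1 y)) = (norm (cinner (b1 y) v))\<^sup>2"
  proof -
    have "cinner v (cinner (b1 y) v *\<^sub>C b1 y) = cinner (b1 y) v * cnj (cinner (b1 y) v)"
      by (simp add: cinner_scaleC_right cinner_commute[of v])
    also have "\<dots> = of_real ((norm (cinner (b1 y) v))\<^sup>2)" by (simp only: complex_norm_square)
    finally show ?thesis by simp
  qed
  ultimately show ?thesis
    using bounded_linear.has_vector_derivative[OF _ X_deriv_segment[OF assms, of v], of "\<lambda>w. Re (cinner v w)"]
    by simp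
qed

lemma X_increasing:
  assumes "u \<in> {p..q}" "w \<in> {p..q}" "u \<le> w"
  shows "0 \<le> Re (cinner v (X w v - X u v))"
proof -
  have "((\<lambda>y. (norm (cinner (b1 y) v))\<^sup>2) has_integral Re (cinner v (X w v)) - Re (cinner v (X u v))) {u..w}"
  proof (rule fundamental_theorem_of_calculus[OF assms(3)])
    fix y assume "y \<in> {u..w}"
    then have y: "y \<in> {p..q}" and sub: "{u..w} \<subseteq> {p..q}" using assms by auto
    show "((\<lambda>y. Re (cinner v (X y v))) has_vector_derivative (norm (cinner (b1 y) v))\<^sup>2) (at y within {u..w})"
      by (rule has_vector_derivative_within_subset[OF quadratic_form_deriv[OF y] sub])
  qed
  then have "0 \<le> Re (cinner v (X w v)) - Re (cinner v (X u v))"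
    by (rule has_integral_nonneg) simp
  then show ?thesis by (simp add: cinner_diff_right)
qed

lemma sum_quadratic_form_le:
  assumes "u \<in> {p..q}" "w \<in> {p..q}" "u \<le> w"
    and "\<And>y. y \<in> {p..q} \<Longrightarrow> (\<Sum>e\<in>S. (norm (cinner (b1 y) (v e)))\<^sup>2) \<le> K"
  shows "(\<Sum>e\<in>S. Re (cinner (v e) (X w (v e) - X u (v e)))) \<le> K * (w - u)"
proof -
  have "norm ((\<Sum>e\<in>S. Re (cinner (v e) (X w (v e)))) - (\<Sum>e\<in>S. Re (cinner (v e) (X u (v e))))) \<le> K * \<bar>w - u\<bar>"
  proof (rule norm_diff_le_derivative_bound[OF _ _ assms(2,1)])
    fix y assume y: "y \<in> {p..q}"
    show "((\<lambda>y. \<Sum>e\<in>S. Re (cinner (v e) (X y (v e)))) has_vector_derivative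
        (\<Sum>e\<in>S. (norm (cinner (b1 y) (v e)))\<^sup>2)) (at y within {p..q})"
      by (intro has_vector_derivative_sum quadratic_form_deriv[OF y])
    show "norm (\<Sum>e\<in>S. (norm (cinner (b1 y) (v e)))\<^sup>2) \<le> K"
      using assms(4)[OF y] by (simp add: sum_nonneg)
  qed
  then show ?thesis using assms(3) by (simp add: cinner_diff_right sum_subtractf)
qed

text \<open>\<open>T = X(w) - X(u)\<close> is positive, so the Cauchy--Schwarz inequality for its form factorises the
  bound on the matrix entries of \<open>N - 1 = \<plusminus>X(x\<^sub>0)\<^sup>-\<^sup>1T\<close>; the two factors are square summable by
  Bessel's inequality for \<open>b\<close> and \<open>c\<close>.\<close>

lemma minors_summable:
  assumes E: "orthonormal E" and y: "y \<in> {p..q}"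
  shows "(\<lambda>F. principal_minor (\<lambda>h. N y h - h) F) summable_on {F. finite F \<and> F \<subseteq> E}"
proof -
  define u w where "u = min x0 y" and "w = max x0 y"
  have uw: "u \<in> {p..q}" "w \<in> {p..q}" "u \<le> w" using x0 y by (auto simp: u_def w_def)
  define T where "T h = X w h - X u h" for h
  define R where "R = inv (X x0)"
  note I = segment_I[OF uw(1)] segment_I[OF uw(2)]
  have T: "bounded_clinear T"
    using X_bounded[OF I(1)] X_bounded[OF I(2)]
    by (auto simp: T_def[abs_def] bounded_clinear_def intro!: bounded_linear_sub
        simp: bounded_bilinear.diff_right[OF bounded_bilinear_scaleC])
  have herm: "cinner (T g) h = cinner g (T h)" for g h
    by (simp add: T_def cinner_diff_left cinner_diff_right X_selfadjoint[OF I(1)] X_selfadjoint[OF I(2)])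
  have psd: "0 \<le> Re (cinner h (T h))" for h
    unfolding T_def by (rule X_increasing[OF uw])
  define \<alpha> where "\<alpha> e = sqrt (Re (cinner (R e) (T (R e))))" for e
  define \<gamma> where "\<gamma> e = sqrt (Re (cinner e (T e)))" for e
  have entry: "norm (cinner e (N y f - f)) \<le> \<alpha> e * \<gamma> f" for e f
  proof -
    have "N y f - f = R (X y f - X x0 f)"
      unfolding N_def R_def by (simp add: linear_diff bounded_linear.linear[OF bounded_linear_inv_X[OF x0_I]]
          X_inv[OF x0_I])
    then have "cinner e (N y f - f) = cinner (R e) (X y f - X x0 f)"
      by (simp add: R_def inv_X_selfadjoint[OF x0_I])
    moreover have "X y f - X x0 f = T f \<or> X y f - X x0 f = - T f"
      by (auto simp: T_def u_def w_def min_def max_def)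
    ultimately have n: "norm (cinner e (N y f - f)) = norm (cinner (R e) (T f))" by auto
    show ?thesis
      unfolding n \<alpha>_def \<gamma>_def real_sqrt_mult[symmetric]
      by (rule real_le_rsqrt[OF psd_Cauchy_Schwarz[OF T herm psd]])
  qed
  obtain M where M: "M > 0" "\<And>y. y \<in> {p..q} \<Longrightarrow> norm (b1 y) \<le> M"
    using bounded_on_segment[OF continuous_b1_segment] by metis
  obtain Mc where Mc: "Mc > 0" "\<And>y. y \<in> {p..q} \<Longrightarrow> norm (c1 y) \<le> Mc"
    using bounded_on_segment[OF continuous_c1] by metis
  have norm_swap: "norm (cinner g h) = norm (cinner h g)" for g h :: 'h
    using cinner_commute[of g h] by simp
  have trace: "(\<Sum>e\<in>S. \<alpha> e * \<gamma> e) \<le> (Mc\<^sup>2 * (w - u) + M\<^sup>2 * (w - u)) / 2"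
    if S: "finite S" "S \<subseteq> E" for S
  proof -
    have on: "orthonormal S" using E S(2) by (rule orthonormal_subset)
    have 1: "(\<Sum>e\<in>S. Re (cinner (R e) (T (R e)))) \<le> Mc\<^sup>2 * (w - u)"
      unfolding T_def
    proof (rule sum_quadratic_form_le[OF uw])
      fix y assume y: "y \<in> {p..q}"
      have "(\<Sum>e\<in>S. (norm (cinner (b1 y) (R e)))\<^sup>2) = (\<Sum>e\<in>S. (norm (cinner e (c1 y)))\<^sup>2)"
        by (simp add: R_def c1_def inv_X_selfadjoint[OF x0_I, symmetric] norm_swap[of "inv (X x0) (b1 y)"])
      also have "\<dots> \<le> (norm (c1 y))\<^sup>2" by (rule Bessel[OF on S(1)])
      also have "\<dots> \<le> Mc\<^sup>2" using Mc(2)[OF y] by (intro power_mono) auto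
      finally show "(\<Sum>e\<in>S. (norm (cinner (b1 y) (R e)))\<^sup>2) \<le> Mc\<^sup>2" .
    qed
    have 2: "(\<Sum>e\<in>S. Re (cinner e (T e))) \<le> M\<^sup>2 * (w - u)"
      unfolding T_def
    proof (rule sum_quadratic_form_le[OF uw])
      fix y assume y: "y \<in> {p..q}"
      have "(\<Sum>e\<in>S. (norm (cinner (b1 y) e))\<^sup>2) = (\<Sum>e\<in>S. (norm (cinner e (b1 y)))\<^sup>2)"
        by (simp add: norm_swap[of "b1 y"])
      also have "\<dots> \<le> (norm (b1 y))\<^sup>2" by (rule Bessel[OF on S(1)])
      also have "\<dots> \<le> M\<^sup>2" using M(2)[OF y] by (intro power_mono) auto
      finally show "(\<Sum>e\<in>S. (norm (cinner (b1 y) e))\<^sup>2) \<le> M\<^sup>2" .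
    qed
    have "\<alpha> e * \<gamma> e \<le> (Re (cinner (R e) (T (R e))) + Re (cinner e (T e))) / 2" for e
      unfolding \<alpha>_def \<gamma>_def real_sqrt_mult[symmetric] by (rule arith_geo_mean_sqrt[OF psd psd])
    then have 3: "(\<Sum>e\<in>S. \<alpha> e * \<gamma> e) \<le> (\<Sum>e\<in>S. (Re (cinner (R e) (T (R e))) + Re (cinner e (T e))) / 2)"
      by (rule sum_mono)
    show ?thesis
      using order_trans[OF 3[unfolded sum_divide_distrib[symmetric] sum.distrib]
          divide_right_mono[OF add_mono[OF 1 2], of 2]] by simp
  qed
  show ?thesis
    unfolding principal_minor_gdet
    by (rule gdet_summable[OF _ entry trace]) (simp_all add: \<alpha>_def \<gamma>_def psd)
qed

section \<open>The tau function\<close>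

lemma vessel_tau_eq_exp:
  assumes G: "\<And>y. y \<in> {p..q} \<Longrightarrow> (G has_vector_derivative - \<beta> y) (at y within {p..q})"
    and G0: "G x0 = 0" and y: "y \<in> {p..q}"
  shows "vessel_tau X x0 y = of_real (exp (G y))"
proof -
  define E where "E = (SOME E :: 'h set. orthonormal_basis E)"
  have E: "orthonormal_basis E" unfolding E_def by (rule someI_ex[OF orthonormal_basis_exists])
  then have on: "orthonormal E" unfolding orthonormal_basis_def orthonormal_def by (rule conjunct1)
  have "((\<lambda>S. principal_minor (N y) S) \<longlongrightarrow> fredholm_det (N y)) (finite_subsets_at_top E)"
    using minors_summable[OF on y] unfolding E_def by (rule fredholm_det_limit)
  moreover have "((\<lambda>S. principal_minor (N y) S) \<longlongrightarrow> of_real (exp (G y))) (finite_subsets_at_top E)"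
    by (rule finite_det_limit[OF E G G0 y])
  ultimately have "fredholm_det (N y) = of_real (exp (G y))"
    by (rule tendsto_unique[OF finite_subsets_at_top_neq_bot])
  moreover have "N y = inv (X x0) \<circ> X y" by (simp add: fun_eq_iff N_def)
  ultimately show ?thesis by (simp add: vessel_tau_def)
qed

lemma ln_vessel_tau_deriv_segment:
  assumes "y \<in> {p..q}"
  shows "((\<lambda>y. ln (vessel_tau X x0 y)) has_vector_derivative - of_real (\<beta> y)) (at y within {p..q})"
proof -
  have "continuous_on {p..q} (\<lambda>y. - \<beta> y)"
    using differentiable_imp_continuous_on[OF beta_differentiable] segment
    by (intro continuous_on_minus) (rule continuous_on_subset)
  from antiderivative_continuous[OF this] obtain G0
    where G0: "\<And>y. y \<in> {p..q} \<Longrightarrow> (G0 has_vector_derivative - \<beta> y) (at y within {p..q})"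
    by metis
  define G where "G y = G0 y - G0 x0" for y
  have G: "(G has_vector_derivative - \<beta> y) (at y within {p..q})" if "y \<in> {p..q}" for y
    unfolding G_def[abs_def] using has_vector_derivative_diff[OF G0[OF that] has_vector_derivative_const] by simp
  have "ln (vessel_tau X x0 y) = of_real (G y)" if "y \<in> {p..q}" for y
    using vessel_tau_eq_exp[OF G _ that] by (simp add: G_def Ln_of_real del: of_real_exp)
  moreover have "((\<lambda>y. complex_of_real (G y)) has_vector_derivative of_real (- \<beta> y)) (at y within {p..q})"
    by (rule bounded_linear.has_vector_derivative[OF bounded_linear_of_real G[OF assms]])
  ultimately show ?thesis
    using has_vector_derivative_transform[OF assms, of "\<lambda>y. ln (vessel_tau X x0 y)" "\<lambda>y. of_real (G y)"]
    by simp
qed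

end

text \<open>This reduces derivatives within \<open>I\<close> to derivatives within a compact segment that also contains
  the base point. At an endpoint of \<open>I\<close> the segment ends there too.\<close>

lemma at_within_interval_eq_segment:
  fixes x x0 :: real
  assumes I: "is_interval I" and x: "x \<in> I" and x0: "x0 \<in> I"
  shows "\<exists>p q. {p..q} \<subseteq> I \<and> x0 \<in> {p..q} \<and> x \<in> {p..q} \<and> at x within I = at x within {p..q}"
proof -
  have lower: "\<exists>p\<in>I. p \<le> x \<and> (p < x \<or> (\<forall>y\<in>I. x \<le> y))"
  proof (cases "\<exists>p\<in>I. p < x")
    case False
    then show ?thesis using x by (intro bexI[of _ x]) auto
  qed (blast intro: less_imp_le)
  have upper: "\<exists>q\<in>I. x \<le> q \<and> (x < q \<or> (\<forall>y\<in>I. y \<le> x))"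
  proof (cases "\<exists>q\<in>I. x < q")
    case False
    then show ?thesis using x by (intro bexI[of _ x]) auto
  qed (blast intro: less_imp_le)
  obtain a where a: "a \<in> I" "a \<le> x" "a < x \<or> (\<forall>y\<in>I. x \<le> y)" using lower by blast
  obtain b where b: "b \<in> I" "x \<le> b" "x < b \<or> (\<forall>y\<in>I. y \<le> x)" using upper by blast
  define p q where "p = min a x0" and "q = max b x0"
  have pq: "p \<in> I" "q \<in> I" using a b x0 by (auto simp: p_def q_def min_def max_def)
  have sub: "{p..q} \<subseteq> I"
  proof
    fix y assume "y \<in> {p..q}"
    then show "y \<in> I" using I[unfolded is_interval_1, rule_format, OF pq, of y] by simp
  qed
  \<comment> \<open>Beyond an endpoint \<open>x\<close> of the interval any margin will do, as it meets no point of \<open>I\<close>.\<close>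
  define l r where "l = (if a < x then a else x - 1)" and "r = (if x < b then b else x + 1)"
  have "a \<le> y \<and> y \<le> b" if "y \<in> I" "l < y" "y < r" for y
    using a(2,3) b(2,3) that by (cases "a < x"; cases "x < b") (auto simp: l_def r_def)
  then have near: "y \<in> {p..q}" if "y \<in> I" "l < y" "y < r" for y
    using that by (fastforce simp: p_def q_def)
  have "at x within I = at x within {p..q}"
  proof (rule at_within_nhd[of x "{l<..<r}"])
    show "x \<in> {l<..<r}" by (simp add: l_def r_def)
    show "I \<inter> {l<..<r} - {x} = {p..q} \<inter> {l<..<r} - {x}"
    proof (intro equalityI subsetI)
      fix y assume "y \<in> I \<inter> {l<..<r} - {x}"
      then show "y \<in> {p..q} \<inter> {l<..<r} - {x}" using near[of y] by simp
    next
      fix y assume "y \<in> {p..q} \<inter> {l<..<r} - {x}"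
      then show "y \<in> I \<inter> {l<..<r} - {x}" using subsetD[OF sub, of y] by simp
    qed
  qed auto
  moreover have "x0 \<in> {p..q}" "x \<in> {p..q}" using a b by (auto simp: p_def q_def)
  ultimately show ?thesis using sub by (intro exI[of _ p] exI[of _ q]) simp
qed

lemma (in sl_vessel) ln_vessel_tau_deriv:
  assumes x0: "x0 \<in> I" and x: "x \<in> I"
  shows "((\<lambda>y. ln (vessel_tau X x0 y)) has_vector_derivative - of_real (\<beta> x)) (at x within I)"
proof -
  obtain p q where pq: "{p..q} \<subseteq> I" "x0 \<in> {p..q}" "x \<in> {p..q}" "at x within I = at x within {p..q}"
    using at_within_interval_eq_segment[OF interval(1) x x0] by (elim exE conjE) (rule that)
  interpret vessel_segment DA A B X \<beta> I p q x0
    by unfold_locales (fact pq)+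
  show ?thesis unfolding pq(4) by (rule ln_vessel_tau_deriv_segment[OF pq(3)])
qed

theorem corollary3p5:
  fixes DA :: "'h::complex_hilbert_space set"
    and A :: "'h \<Rightarrow> 'h"
    and B :: "real \<Rightarrow> complex ^ 2 \<Rightarrow> 'h"
    and X :: "real \<Rightarrow> 'h \<Rightarrow> 'h"
    and \<beta> :: "real \<Rightarrow> real"
    and I :: "real set"
    and x0 :: real
  assumes "sl_vessel DA A B X \<beta> I"
    and "x0 \<in> I"
  shows "\<exists>L1 L2. \<forall>x\<in>I.
    ((\<lambda>y. ln (vessel_tau X x0 y)) has_vector_derivative L1 x) (at x within I)
    \<and> (L1 has_vector_derivative L2 x) (at x within I)
    \<and> complex_of_real (sl_potential I \<beta> x) = - 2 * L2 x"
proof -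
  interpret sl_vessel DA A B X \<beta> I by fact
  define L1 where "L1 y = - complex_of_real (\<beta> y)" for y
  define L2 where "L2 y = - complex_of_real (vector_derivative \<beta> (at y within I))" for y
  have "((\<lambda>y. ln (vessel_tau X x0 y)) has_vector_derivative L1 x) (at x within I)" if "x \<in> I" for x
    unfolding L1_def by (rule ln_vessel_tau_deriv[OF assms(2) that])
  moreover have "(L1 has_vector_derivative L2 x) (at x within I)" if "x \<in> I" for x
  proof -
    have "(\<beta> has_vector_derivative vector_derivative \<beta> (at x within I)) (at x within I)"
      using beta_differentiable that by (simp add: differentiable_on_def vector_derivative_works)
    then show ?thesis
      unfolding L1_def[abs_def] L2_def
      by (intro has_vector_derivative_minus bounded_linear.has_vector_derivative[OF bounded_linear_of_real])
  qed
  moreover have "complex_of_real (sl_potential I \<beta> x) = - 2 * L2 x" for x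
    by (simp add: sl_potential_def L2_def)
  ultimately show ?thesis by blast
qed

end
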